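(* Let $\mathcal{H}$ be a partially reflexive path. If $\mathcal{H}$ is quasi-loop-connected, then the algebra $\mathrm{id\mbox{-}Pol}(\mathcal{H})$ has the PGP. Otherwise, $\mathrm{id\mbox{-}Pol}(\mathcal{H})$ has the EGP.
   Context: For a word $\beta\in\{0,1\}^n$, $\mathcal{P}_\beta$ denotes the undirected graph (symmetric edge relation $E$) on vertices $1,\dots,n$ with edges between $i$ and $i+1$ for $i<n$, and with a loop at vertex $i$ iff the $i$-th letter of $\beta$ is $1$. A partially reflexive path is a graph isomorphic to some $\mathcal{P}_\beta$. It is quasi-loop-connected if it is isomorphic to $\mathcal{P}_\beta$ for some $\beta$ of one of the forms: (i) $\beta=0^a1^b\alpha$ with $b>0$ and $|\alpha|=a$; or (ii) $\beta=0^a\alpha$ with $|\alpha|\in\{a,a-1\}$. A $k$-ary polymorphism of a structure with domain $A$ is a map $f:A^k\to A$ such that applying $f$ coordinatewise to tuples of any relation yields a tuple of that relation; it is idempotent if $f(a,\dots,a)=a$ for all $a$. $\mathrm{id\mbox{-}Pol}(\mathcal{H})$ is the set of idempotent polymorphisms of $\mathcal{H}$, viewed as an algebra $\mathbb{A}$ on the vertex set $A$. A set $S\subseteq A^m$ generates $\mathbb{A}^m$ if every $t\in A^m$ equals $f$ applied coordinatewise to some $s_1,\dots,s_k\in S$, for some $k$-ary $f\in\mathrm{id\mbox{-}Pol}(\mathcal{H})$. Let $f_{\mathbb{A}}(m)$ be the minimum size of a generating set of $\mathbb{A}^m$. $\mathbb{A}$ has the PGP (polynomially generated powers) if $f_{\mathbb{A}}(m)=O(p(m))$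 for some polynomial $p$, and the EGP (exponentially generated powers) if $f_{\mathbb{A}}(m)=\Omega(b^m)$ for some constant $b>1$. *)

theory Defs
  imports
    "HOL-Library.NList"
    "HOL-Library.Landau_Symbols"
    "HOL-Computational_Algebra.Polynomial"
begin

record 'a graph =
  verts :: "'a set"
  edges :: "('a \<times> 'a) set"

definition undirected_graph :: "'a graph \<Rightarrow> bool" where
  "undirected_graph G \<longleftrightarrow> edges G \<subseteq> verts G \<times> verts G \<and> sym (edges G)"

definition graph_iso :: "'a graph \<Rightarrow> 'b graph \<Rightarrow> bool" where
  "graph_iso G H \<longleftrightarrow>
    (\<exists>h. bij_betw h (verts G) (verts H) \<and>
      (\<forall>x\<in>verts G. \<forall>y\<in>verts G. (x, y) \<in> edges G \<longleftrightarrow> (h x, h y) \<in> edges H))"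

text \<open>Words over the alphabet 0, 1 are boolean lists, with \<open>True\<close> for the letter 1.
  Vertices are numbered from 1, list positions from 0.\<close>

definition path_graph :: "bool list \<Rightarrow> nat graph" where
  "path_graph \<beta> = \<lparr>
    verts = {1..length \<beta>},
    edges = {(i, i + 1) | i. 1 \<le> i \<and> i < length \<beta>} \<union>
            {(i + 1, i) | i. 1 \<le> i \<and> i < length \<beta>} \<union>
            {(i, i) | i. 1 \<le> i \<and> i \<le> length \<beta> \<and> \<beta> ! (i - 1)}\<rparr>"

definition partially_reflexive_path :: "'a graph \<Rightarrow> bool" where
  "partially_reflexive_path H \<longleftrightarrow> undirected_graph H \<and> (\<exists>\<beta>. graph_iso H (path_graph \<beta>))"

definition quasi_loop_connected_word :: "bool list \<Rightarrow> bool" where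
  "quasi_loop_connected_word \<beta> \<longleftrightarrow>
    (\<exists>a b \<alpha>. \<beta> = replicate a False @ replicate b True @ \<alpha> \<and> b > 0 \<and> length \<alpha> = a) \<or>
    (\<exists>a \<alpha>. \<beta> = replicate a False @ \<alpha> \<and> (length \<alpha> = a \<or> length \<alpha> + 1 = a))"

definition quasi_loop_connected :: "'a graph \<Rightarrow> bool" where
  "quasi_loop_connected H \<longleftrightarrow>
    undirected_graph H \<and> (\<exists>\<beta>. quasi_loop_connected_word \<beta> \<and> graph_iso H (path_graph \<beta>))"

text \<open>The power \<open>A\<^sup>m\<close> is \<open>nlists m A\<close>, the set of lists of length \<open>m\<close> over \<open>A\<close>. A \<open>k\<close>-ary operation
  on \<open>A\<close> is a function on lists of which only the values on \<open>nlists k A\<close> matter.\<close>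

definition polymorphism :: "'a graph \<Rightarrow> nat \<Rightarrow> ('a list \<Rightarrow> 'a) \<Rightarrow> bool" where
  "polymorphism H k f \<longleftrightarrow>
    (\<forall>xs\<in>nlists k (verts H). f xs \<in> verts H) \<and>
    (\<forall>xs\<in>nlists k (verts H). \<forall>ys\<in>nlists k (verts H).
      (\<forall>i<k. (xs ! i, ys ! i) \<in> edges H) \<longrightarrow> (f xs, f ys) \<in> edges H)"

definition idempotent :: "'a set \<Rightarrow> nat \<Rightarrow> ('a list \<Rightarrow> 'a) \<Rightarrow> bool" where
  "idempotent A k f \<longleftrightarrow> (\<forall>a\<in>A. f (replicate k a) = a)"

text \<open>\<open>operations \<AA> k\<close> is the set of \<open>k\<close>-ary operations of the algebra \<open>\<AA>\<close>.\<close>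

record 'a algebra =
  universe :: "'a set"
  operations :: "nat \<Rightarrow> ('a list \<Rightarrow> 'a) set"

definition id_Pol :: "'a graph \<Rightarrow> 'a algebra" where
  "id_Pol H = \<lparr>
    universe = verts H,
    operations = (\<lambda>k. {f. k \<ge> 1 \<and> polymorphism H k f \<and> idempotent (verts H) k f})\<rparr>"

definition coordinatewise :: "nat \<Rightarrow> ('a list \<Rightarrow> 'a) \<Rightarrow> 'a list list \<Rightarrow> 'a list" where
  "coordinatewise m f ss = map (\<lambda>j. f (map (\<lambda>s. s ! j) ss)) [0..<m]"

text \<open>One operation is applied once, with no closure under composition; for \<open>id_Pol H\<close> this
  loses nothing, its operations being closed under composition.\<close>

definition generates_power :: "'a algebra \<Rightarrow> nat \<Rightarrow> 'a list set \<Rightarrow> bool" where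
  "generates_power \<AA> m S \<longleftrightarrow>
    S \<subseteq> nlists m (universe \<AA>) \<and>
    (\<forall>t\<in>nlists m (universe \<AA>). \<exists>k. \<exists>f\<in>operations \<AA> k. \<exists>ss\<in>nlists k S. t = coordinatewise m f ss)"

definition min_generators :: "'a algebra \<Rightarrow> nat \<Rightarrow> nat" where
  "min_generators \<AA> m = (LEAST n. \<exists>S. finite S \<and> card S = n \<and> generates_power \<AA> m S)"

definition PGP :: "'a algebra \<Rightarrow> bool" where
  "PGP \<AA> \<longleftrightarrow> (\<exists>p :: real poly. (\<lambda>m. real (min_generators \<AA> m)) \<in> O(\<lambda>m. poly p (real m)))"

definition EGP :: "'a algebra \<Rightarrow> bool" where
  "EGP \<AA> \<longleftrightarrow> (\<exists>b :: real. b > 1 \<and> (\<lambda>m. real (min_generators \<AA> m)) \<in> \<Omega>(\<lambda>m. b ^ m))"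

end

theory Submission
  imports Defs
begin

text \<open>
  PGP: a word is quasi-loop-connected iff it has no letter 1 or, for some \<open>L\<close>, consists of
  \<open>L\<close> zeros, a nonempty block of ones and at most \<open>L\<close> further letters. In both cases there are a
  ternary idempotent polymorphism and an end \<open>s\<close> of the path such that fixing any one argument to
  \<open>s\<close> still leaves the operation surjective. Hence every \<open>m\<close>-tuple is generated by those with at
  most two entries different from \<open>s\<close>, of which there are \<open>O(m\<^sup>2)\<close>.

  EGP: let \<open>P\<close> and \<open>Q\<close> be consecutive loops with only loopless vertices, and at least one,
  in between. Walking from \<open>(P, \<dots>, P)\<close> to \<open>(Q, \<dots>, Q)\<close> one argument at a time, an idempotent
  polymorphism has to jump from \<open>P\<close> to \<open>Q\<close> at some argument \<open>i\<close>, and this forces it to be the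
  \<open>i\<close>-th projection on all tuples with \<open>i\<close>-th entry in \<open>{P..Q}\<close>. On tuples of loops its value stays
  on the same side of the gap as the \<open>i\<close>-th entry. If every vertex is within distance \<open>h\<close> of a loop
  and \<open>P + h < n\<close>, \<open>h + 1 < Q\<close>, then an \<open>i\<close>-th entry up to \<open>P\<close> excludes the value \<open>n\<close> and a larger
  one excludes the value \<open>1\<close>. So a generating set has at least as many elements as \<open>{1, n}\<^sup>m\<close>.
\<close>

subsection \<open>Generating powers\<close>

text \<open>As rewrite rules these two loop together with \<open>nlists_iff_nth\<close>.\<close>

declare nlistsE_length [simp del] nlistsE_set [simp del]

lemma nlists_iff_nth: "xs \<in> nlists n A \<longleftrightarrow> length xs = n \<and> (\<forall>i<n. xs ! i \<in> A)"
  unfolding nlists_def by (auto simp: in_set_conv_nth subset_iff)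

lemma card_nlists: "finite A \<Longrightarrow> card (nlists n A) = card A ^ n"
  unfolding nlists_def using card_lists_length_eq[of A n] by (metis (no_types, lifting) Collect_cong)

lemma finite_nlists: "finite A \<Longrightarrow> finite (nlists n A)"
  unfolding nlists_def using finite_lists_length_eq[of A n] by (metis (no_types, lifting) Collect_cong)

lemma length_coordinatewise [simp]: "length (coordinatewise m f ss) = m"
  by (simp add: coordinatewise_def)

lemma nth_coordinatewise [simp]:
  "j < m \<Longrightarrow> coordinatewise m f ss ! j = f (map (\<lambda>s. s ! j) ss)"
  by (simp add: coordinatewise_def)

section \<open>Operations of \<open>id_Pol\<close> and smallest generating sets\<close>

lemma universe_id_Pol [simp]: "universe (id_Pol H) = verts H"
  by (simp add: id_Pol_def)

lemma operations_id_Pol: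
  "f \<in> operations (id_Pol H) k \<longleftrightarrow>
     k \<ge> 1 \<and> polymorphism H k f \<and> idempotent (verts H) k f"
  by (simp add: id_Pol_def)

lemma nth_in_operations: "i < k \<Longrightarrow> (\<lambda>xs. xs ! i) \<in> operations (id_Pol H) k"
  by (auto simp: operations_id_Pol polymorphism_def idempotent_def nlists_iff_nth)

text \<open>Generation applies a single operation once, so generating a tuple through intermediate
  tuples requires collapsing nested operations into one.\<close>

lemma compose_in_operations:
  assumes f: "f \<in> operations (id_Pol H) k" and g: "\<And>i. i < k \<Longrightarrow> g i \<in> operations (id_Pol H) l"
  shows "(\<lambda>xs. f (map (\<lambda>i. g i xs) [0..<k])) \<in> operations (id_Pol H) l"
proof -
  have f1: "k \<ge> 1" "polymorphism H k f" "idempotent (verts H) k f"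
    using f by (auto simp: operations_id_Pol)
  have g1: "polymorphism H l (g i)" "idempotent (verts H) l (g i)" if "i < k" for i
    using g[OF that] by (auto simp: operations_id_Pol)
  have inV: "map (\<lambda>i. g i xs) [0..<k] \<in> nlists k (verts H)" if "xs \<in> nlists l (verts H)" for xs
    using g1 that by (auto simp: nlists_iff_nth[of _ k] polymorphism_def)
  have "l \<ge> 1"
    using g[of 0] f1(1) by (simp add: operations_id_Pol)
  moreover have "polymorphism H l (\<lambda>xs. f (map (\<lambda>i. g i xs) [0..<k]))"
    unfolding polymorphism_def
  proof (intro conjI ballI impI)
    fix xs assume "xs \<in> nlists l (verts H)"
    then show "f (map (\<lambda>i. g i xs) [0..<k]) \<in> verts H"
      using inV f1(2) by (auto simp: polymorphism_def)
  next
    fix xs ys assume *: "xs \<in> nlists l (verts H)" "ys \<in> nlists l (verts H)"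
      "\<forall>i<l. (xs ! i, ys ! i) \<in> edges H"
    have "(g i xs, g i ys) \<in> edges H" if "i < k" for i
      using g1(1)[OF that] * by (auto simp: polymorphism_def)
    then show "(f (map (\<lambda>i. g i xs) [0..<k]), f (map (\<lambda>i. g i ys) [0..<k])) \<in> edges H"
      using inV * f1(2) by (auto simp: polymorphism_def)
  qed
  moreover have "idempotent (verts H) l (\<lambda>xs. f (map (\<lambda>i. g i xs) [0..<k]))"
    unfolding idempotent_def
  proof
    fix a assume a: "a \<in> verts H"
    have "map (\<lambda>i. g i (replicate l a)) [0..<k] = replicate k a"
      using g1(2) a by (intro nth_equalityI) (auto simp: idempotent_def)
    then show "f (map (\<lambda>i. g i (replicate l a)) [0..<k]) = a"
      using f1(3) a by (simp add: idempotent_def)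
  qed
  ultimately show ?thesis by (simp add: operations_id_Pol)
qed

text \<open>Ensures that the \<open>LEAST\<close> in \<open>min_generators\<close> ranges over a
  nonempty set when the graph is finite.\<close>

lemma generates_power_nlists: "generates_power (id_Pol H) m (nlists m (verts H))"
  unfolding generates_power_def
proof (intro conjI ballI)
  fix t assume t: "t \<in> nlists m (universe (id_Pol H))"
  then have "t = coordinatewise m (\<lambda>xs. xs ! 0) [t]"
    by (intro nth_equalityI) (auto simp: nlists_iff_nth)
  moreover have "[t] \<in> nlists 1 (nlists m (verts H))" using t by simp
  ultimately show "\<exists>k. \<exists>f\<in>operations (id_Pol H) k. \<exists>ss\<in>nlists k (nlists m (verts H)).
      t = coordinatewise m f ss"
    by (intro exI[of _ 1] bexI[of _ "\<lambda>xs. xs ! 0"] bexI[of _ "[t]"]) (auto intro: nth_in_operations)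
qed simp

lemma min_generators_le:
  assumes "generates_power \<AA> m S" "finite S"
  shows "min_generators \<AA> m \<le> card S"
  unfolding min_generators_def using assms by (intro Least_le) auto

lemma min_generators_attained:
  assumes "finite (verts H)"
  obtains S where "finite S" "card S = min_generators (id_Pol H) m" "generates_power (id_Pol H) m S"
proof -
  have "\<exists>n S. finite S \<and> card S = n \<and> generates_power (id_Pol H) m S"
    using generates_power_nlists finite_nlists[OF assms] by blast
  from LeastI_ex[OF this] show ?thesis
    using that unfolding min_generators_def by blast
qed

text \<open>If an entry \<open>x\<close> in any one argument of \<open>f\<close> still allows every value, then a tuple in which
  at least \<open>k\<close> entries differ from \<open>x\<close> is the image of tuples in which fewer do: at \<open>k\<close> such
  positions let the arguments have an \<open>x\<close> in turn, and use idempotency at the others.\<close>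

lemma generates_power_near_constant:
  assumes fin: "finite (verts H)" and x: "x \<in> verts H"
    and f: "f \<in> operations (id_Pol H) k"
    and surj: "\<And>i a. i < k \<Longrightarrow> a \<in> verts H \<Longrightarrow>
      \<exists>xs\<in>nlists k (verts H). xs ! i = x \<and> f xs = a"
  shows "generates_power (id_Pol H) m {t\<in>nlists m (verts H). card {j. j < m \<and> t ! j \<noteq> x} < k}"
    (is "generates_power _ m ?S")
proof -
  let ?D = "\<lambda>t. {j. j < m \<and> t ! j \<noteq> x}"
  have finS: "finite ?S" using finite_nlists[OF fin] by auto
  then obtain ss where ss: "set ss = ?S" using finite_list by blast
  define l where "l = length ss"
  have ssS: "ss \<in> nlists l ?S" by (simp add: nlists_def ss l_def)
  have k: "k \<ge> 1" and idf: "idempotent (verts H) k f" using f by (auto simp: operations_id_Pol)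
  have main: "\<exists>g\<in>operations (id_Pol H) l. t = coordinatewise m g ss"
    if "t \<in> nlists m (verts H)" for t
    using that
  proof (induction "card (?D t)" arbitrary: t rule: less_induct)
    case less
    have t: "length t = m" "\<And>j. j < m \<Longrightarrow> t ! j \<in> verts H"
      using less.prems by (auto simp: nlists_iff_nth)
    show ?case
    proof (cases "card (?D t) < k")
      case True
      then have "t \<in> set ss" using less.prems ss by simp
      then obtain i where i: "i < l" "ss ! i = t" by (auto simp: in_set_conv_nth l_def)
      have "t = coordinatewise m (\<lambda>xs. xs ! i) ss"
        using i t by (intro nth_equalityI) (auto simp: l_def)
      then show ?thesis using nth_in_operations[OF i(1)] by blast
    next
      case False
      then obtain D where D: "D \<subseteq> ?D t" "card D = k"
        by (meson not_less obtain_subset_with_card_n)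
      then have "finite D" by (auto intro: finite_subset[of _ "{..<m}"])
      then obtain js where js: "set js = D" "distinct js"
        using finite_distinct_list by blast
      then have lenjs: "length js = k" using D(2) distinct_card by fastforce
      have "\<exists>xs\<in>nlists k (verts H). f xs = t ! j \<and> (\<forall>i<k. j = js ! i \<longrightarrow> xs ! i = x) \<and>
          (j \<notin> D \<longrightarrow> xs = replicate k (t ! j))" if j: "j < m" for j
      proof (cases "j \<in> D")
        case True
        then obtain i where i: "i < k" "js ! i = j" using js lenjs by (auto simp: in_set_conv_nth)
        obtain xs where "xs \<in> nlists k (verts H)" "xs ! i = x" "f xs = t ! j"
          using surj[OF i(1) t(2)[OF j]] by blast
        then show ?thesis using i js(2) lenjs True
          by (intro bexI[of _ xs]) (auto simp: nth_eq_iff_index_eq)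
      next
        case False
        then show ?thesis using t(2)[OF j] idf js lenjs
          by (intro bexI[of _ "replicate k (t ! j)"]) (auto simp: idempotent_def)
      qed
      then obtain arg where arg: "\<And>j. j < m \<Longrightarrow> arg j \<in> nlists k (verts H)"
        "\<And>j. j < m \<Longrightarrow> f (arg j) = t ! j"
        "\<And>j i. j < m \<Longrightarrow> i < k \<Longrightarrow> j = js ! i \<Longrightarrow> arg j ! i = x"
        "\<And>j. j < m \<Longrightarrow> j \<notin> D \<Longrightarrow> arg j = replicate k (t ! j)"
        by metis
      define s where "s i = map (\<lambda>j. arg j ! i) [0..<m]" for i
      have "\<exists>g\<in>operations (id_Pol H) l. s i = coordinatewise m g ss" if i: "i < k" for i
      proof (rule less.hyps)
        show "s i \<in> nlists m (verts H)"
          using arg(1) i by (auto simp: s_def nlists_iff_nth)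
        have jsi: "js ! i \<in> ?D t" using i js D lenjs by (metis nth_mem subsetD)
        have "?D (s i) \<subseteq> ?D t"
          using D(1) arg(4) i by (fastforce simp: s_def)
        moreover have "js ! i \<notin> ?D (s i)" using arg(3) i jsi by (auto simp: s_def)
        ultimately have "?D (s i) \<subset> ?D t" using jsi by blast
        then show "card (?D (s i)) < card (?D t)" by (intro psubset_card_mono) auto
      qed
      then obtain g where g: "\<And>i. i < k \<Longrightarrow> g i \<in> operations (id_Pol H) l"
        "\<And>i. i < k \<Longrightarrow> s i = coordinatewise m (g i) ss" by metis
      have "t = coordinatewise m (\<lambda>xs. f (map (\<lambda>i. g i xs) [0..<k])) ss"
      proof (rule nth_equalityI)
        fix j assume "j < length t"
        then have j: "j < m" using t by (simp add: nlists_iff_nth)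
        have "map (\<lambda>i. g i (map (\<lambda>s. s ! j) ss)) [0..<k] = arg j"
        proof (rule nth_equalityI)
          fix i assume "i < length (map (\<lambda>i. g i (map (\<lambda>s. s ! j) ss)) [0..<k])"
          then have i: "i < k" by simp
          have "arg j ! i = s i ! j" using j by (simp add: s_def)
          also have "\<dots> = g i (map (\<lambda>s. s ! j) ss)" using g(2)[OF i] j by simp
          finally show "map (\<lambda>i. g i (map (\<lambda>s. s ! j) ss)) [0..<k] ! i = arg j ! i" using i by simp
        qed (use arg(1)[OF j] in \<open>simp add: nlists_iff_nth\<close>)
        then show "t ! j = coordinatewise m (\<lambda>xs. f (map (\<lambda>i. g i xs) [0..<k])) ss ! j"
          using j arg(2) by simp
      qed (use t in \<open>simp add: nlists_iff_nth\<close>)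
      moreover have "(\<lambda>xs. f (map (\<lambda>i. g i xs) [0..<k])) \<in> operations (id_Pol H) l"
        using f g(1) by (rule compose_in_operations)
      ultimately show ?thesis by blast
    qed
  qed
  show ?thesis unfolding generates_power_def
  proof (intro conjI ballI)
    fix t assume "t \<in> nlists m (universe (id_Pol H))"
    then obtain g where "g \<in> operations (id_Pol H) l" "t = coordinatewise m g ss"
      using main by auto
    then show "\<exists>k. \<exists>f\<in>operations (id_Pol H) k. \<exists>ss\<in>nlists k ?S. t = coordinatewise m f ss"
      using ssS by blast
  qed auto
qed

text \<open>Each such tuple can be decoded from a list of \<open>k\<close> pairs of a position and
  an entry, with \<open>x\<close> as the default elsewhere.\<close>

lemma card_near_constant_le:
  assumes fin: "finite A" and m: "m > 0"
  shows "card {t\<in>nlists m A. card {j. j < m \<and> t ! j \<noteq> x} < k} \<le> (m * card A) ^ k"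
    (is "card ?S \<le> _")
proof -
  let ?dec = "\<lambda>ps. map (\<lambda>j. case map_of ps j of None \<Rightarrow> x | Some a \<Rightarrow> a) [0..<m]"
  have "?S \<subseteq> ?dec ` nlists k ({..<m} \<times> A)"
  proof
    fix t assume "t \<in> ?S"
    then have t: "length t = m" "\<And>j. j < m \<Longrightarrow> t ! j \<in> A" and c: "card {j. j < m \<and> t ! j \<noteq> x} < k"
      by (auto simp: nlists_iff_nth)
    obtain js where js: "set js = {j. j < m \<and> t ! j \<noteq> x}" "distinct js"
      using finite_distinct_list[of "{j. j < m \<and> t ! j \<noteq> x}"] by auto
    then have len: "length js < k" using c by (metis distinct_card)
    \<comment> \<open>Padding to length \<open>k\<close> repeats position 0, which exists as
      \<open>m > 0\<close>; its pair carries the true entry \<open>t ! 0\<close>, so decoding is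
      unaffected.\<close>
    define ks where "ks = js @ replicate (k - length js) 0"
    let ?ps = "map (\<lambda>j. (j, t ! j)) ks"
    have "set ks \<subseteq> set js \<union> {0}" by (auto simp: ks_def)
    then have ks: "j < m" if "j \<in> set ks" for j using js(1) m that by auto
    have "length ks = k" using len by (simp add: ks_def)
    then have "?ps \<in> nlists k ({..<m} \<times> A)"
      using ks t(2) by (auto simp: nlists_def)
    moreover have "?dec ?ps = t"
    proof (rule nth_equalityI)
      fix j assume "j < length (?dec ?ps)"
      then have j: "j < m" by simp
      have "map_of ?ps j = (if j \<in> set ks then Some (t ! j) else None)"
        by (simp add: map_of_map_restrict restrict_map_def)
      moreover have "t ! j = x" if "j \<notin> set ks" using that j js(1) unfolding ks_def by auto
      ultimately show "?dec ?ps ! j = t ! j" using j by auto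
    qed (use t in \<open>simp add: nlists_iff_nth\<close>)
    ultimately show "t \<in> ?dec ` nlists k ({..<m} \<times> A)" by (rule rev_image_eqI[OF _ sym])
  qed
  then have "card ?S \<le> card (nlists k ({..<m} \<times> A))"
    using fin by (intro surj_card_le finite_nlists) auto
  then show ?thesis using fin by (simp add: card_nlists card_cartesian_product)
qed

lemma PGP_if_surjective_with_fixed_entry:
  assumes "finite (verts H)" and "x \<in> verts H"
    and "f \<in> operations (id_Pol H) k"
    and "\<And>i a. i < k \<Longrightarrow> a \<in> verts H \<Longrightarrow>
      \<exists>xs\<in>nlists k (verts H). xs ! i = x \<and> f xs = a"
  shows "PGP (id_Pol H)"
proof -
  let ?c = "card (verts H)"
  have le: "min_generators (id_Pol H) m \<le> (m * ?c) ^ k" if "m > 0" for m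
    using min_generators_le[OF generates_power_near_constant[OF assms, of m]]
      card_near_constant_le[OF assms(1) that, of x k] finite_nlists[OF assms(1), of m]
    by fastforce
  have "(\<lambda>m. real (min_generators (id_Pol H) m)) \<in> O(\<lambda>m. poly ([:0, real ?c:] ^ k) (real m))"
  proof (rule bigoI[where c = 1], rule eventually_mono[OF eventually_gt_at_top[of 0]])
    fix m :: nat assume "m > 0"
    then have "real (min_generators (id_Pol H) m) \<le> real ((m * ?c) ^ k)"
      using le of_nat_le_iff by blast
    then show "norm (real (min_generators (id_Pol H) m))
        \<le> 1 * norm (poly ([:0, real ?c:] ^ k) (real m))" by simp
  qed
  then show ?thesis unfolding PGP_def by blast
qed

text \<open>The near-constant tuples need a vertex to be constant at. Without vertices a power has
  at most one element.\<close>

lemma PGP_empty: "verts H = {} \<Longrightarrow> PGP (id_Pol H)"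
proof -
  assume V: "verts H = {}"
  have "min_generators (id_Pol H) m \<le> 1" for m
    using min_generators_le[OF generates_power_nlists[of H m]] V card_nlists[of "{} :: 'a set" m]
      finite_nlists[of "{} :: 'a set" m] by (cases m) auto
  then have "(\<lambda>m. real (min_generators (id_Pol H) m)) \<in> O(\<lambda>m. poly 1 (real m))"
    by (intro bigoI[where c = 1]) auto
  then show ?thesis unfolding PGP_def by blast
qed

text \<open>Every generating set contains, for each tuple over \<open>{a, b}\<close>, an argument from which that
  tuple can be decoded.\<close>

lemma EGP_if_separating:
  assumes fin: "finite (verts H)" and ab: "a \<in> verts H" "b \<in> verts H" "a \<noteq> b"
    and sep: "\<And>k f. f \<in> operations (id_Pol H) k \<Longrightarrow>
      \<exists>i<k. \<forall>xs\<in>nlists k (verts H). (xs ! i \<in> B \<longrightarrow> f xs \<noteq> b) \<and> (xs ! i \<notin> B \<longrightarrow> f xs \<noteq> a)"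
  shows "EGP (id_Pol H)"
proof -
  let ?dec = "map (\<lambda>u. if u \<in> B then a else b)"
  have le: "2 ^ m \<le> min_generators (id_Pol H) m" for m
  proof -
    obtain S where S: "finite S" "card S = min_generators (id_Pol H) m" "generates_power (id_Pol H) m S"
      using min_generators_attained[OF fin] by blast
    have "nlists m {a, b} \<subseteq> ?dec ` S"
    proof
      fix t assume t: "t \<in> nlists m {a, b}"
      then have "t \<in> nlists m (verts H)" using nlists_mono[of "{a, b}" "verts H" m] ab by auto
      then obtain k f ss where f: "f \<in> operations (id_Pol H) k" and ss: "ss \<in> nlists k S"
        and teq: "t = coordinatewise m f ss"
        using S(3) by (auto simp: generates_power_def)
      obtain i where i: "i < k" and sepi: "\<And>xs. xs \<in> nlists k (verts H) \<Longrightarrow>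
          (xs ! i \<in> B \<longrightarrow> f xs \<noteq> b) \<and> (xs ! i \<notin> B \<longrightarrow> f xs \<noteq> a)"
        using sep[OF f] by blast
      have ssi: "ss ! l \<in> S" "ss ! l \<in> nlists m (verts H)" if "l < k" for l
        using ss S(3) that by (auto simp: nlists_iff_nth[of _ k] generates_power_def)
      have "t = ?dec (ss ! i)"
      proof (rule nth_equalityI)
        fix j assume "j < length t"
        then have j: "j < m" using t by (simp add: nlists_iff_nth)
        let ?xs = "map (\<lambda>s. s ! j) ss"
        have "?xs \<in> nlists k (verts H)"
          using ss ssi j by (auto simp: nlists_iff_nth)
        moreover have "?xs ! i = ss ! i ! j" using i ss by (simp add: nlists_iff_nth)
        moreover have "f ?xs = t ! j" using teq j by simp
        moreover have "t ! j = a \<or> t ! j = b" using t j by (auto simp: nlists_iff_nth)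
        ultimately show "t ! j = ?dec (ss ! i) ! j"
          using sepi[of ?xs] ssi(2)[OF i] j by (auto simp: nlists_iff_nth)
      qed (use t ssi(2)[OF i] in \<open>simp add: nlists_iff_nth\<close>)
      then show "t \<in> ?dec ` S" using ssi(1)[OF i] by blast
    qed
    then have "card (nlists m {a, b}) \<le> card S" using S(1) by (rule surj_card_le[rotated])
    then show ?thesis using ab(3) S(2) by (simp add: card_nlists numeral_2_eq_2)
  qed
  have "(\<lambda>m. real (min_generators (id_Pol H) m)) \<in> \<Omega>(\<lambda>m. 2 ^ m)"
  proof (rule landau_omega.bigI[where c = 1])
    show "\<forall>\<^sub>F m in sequentially. norm (real (min_generators (id_Pol H) m)) \<ge> 1 * norm ((2::real) ^ m)"
      using le by (intro always_eventually allI) (simp flip: of_nat_le_iff)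
  qed simp
  then show ?thesis unfolding EGP_def by (intro exI[of _ 2]) auto
qed

section \<open>Invariance under graph isomorphism\<close>

lemma graph_iso_sym: "graph_iso G H \<Longrightarrow> graph_iso H G"
proof -
  assume "graph_iso G H"
  then obtain h where h: "bij_betw h (verts G) (verts H)"
    "\<forall>x\<in>verts G. \<forall>y\<in>verts G. (x, y) \<in> edges G \<longleftrightarrow> (h x, h y) \<in> edges H"
    by (auto simp: graph_iso_def)
  let ?g = "inv_into (verts G) h"
  have "?g x \<in> verts G" "h (?g x) = x" if "x \<in> verts H" for x
    using h(1) that by (auto simp: bij_betw_def inv_into_into f_inv_into_f)
  then have "(x, y) \<in> edges H \<longleftrightarrow> (?g x, ?g y) \<in> edges G"
    if "x \<in> verts H" "y \<in> verts H" for x y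
    using that h(2) by force
  then show ?thesis using bij_betw_inv_into[OF h(1)] by (auto simp: graph_iso_def)
qed

lemma graph_iso_trans: "graph_iso G H \<Longrightarrow> graph_iso H K \<Longrightarrow> graph_iso G K"
proof -
  assume "graph_iso G H" "graph_iso H K"
  then obtain h g where h: "bij_betw h (verts G) (verts H)"
    "\<forall>x\<in>verts G. \<forall>y\<in>verts G. (x, y) \<in> edges G \<longleftrightarrow> (h x, h y) \<in> edges H"
    and g: "bij_betw g (verts H) (verts K)"
    "\<forall>x\<in>verts H. \<forall>y\<in>verts H. (x, y) \<in> edges H \<longleftrightarrow> (g x, g y) \<in> edges K"
    by (auto simp: graph_iso_def)
  then have "\<forall>x\<in>verts G. \<forall>y\<in>verts G. (x, y) \<in> edges G \<longleftrightarrow> ((g \<circ> h) x, (g \<circ> h) y) \<in> edges K"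
    by (simp add: bij_betwE)
  then show ?thesis using bij_betw_trans[OF h(1) g(1)] unfolding graph_iso_def by blast
qed

text \<open>Conjugation by the isomorphism turns operations of \<open>id_Pol G\<close> into
  operations of \<open>id_Pol H\<close>, so the image of a smallest generating set
  generates.\<close>

lemma min_generators_graph_iso_le:
  assumes iso: "graph_iso G H" and fin: "finite (verts G)"
  shows "min_generators (id_Pol H) m \<le> min_generators (id_Pol G) m"
proof -
  obtain h where h: "bij_betw h (verts G) (verts H)"
    and hE: "\<And>x y. x \<in> verts G \<Longrightarrow> y \<in> verts G \<Longrightarrow> (x, y) \<in> edges G \<longleftrightarrow> (h x, h y) \<in> edges H"
    using iso by (auto simp: graph_iso_def)
  define g where "g = inv_into (verts G) h"
  have gh: "g (h x) = x" "h x \<in> verts H" if "x \<in> verts G" for x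
    using h that by (auto simp: g_def bij_betw_def)
  have hg: "h (g x) = x" "g x \<in> verts G" if "x \<in> verts H" for x
    using h that by (auto simp: g_def bij_betw_def inv_into_into f_inv_into_f)
  have mapg: "map g xs \<in> nlists k (verts G)" if "xs \<in> nlists k (verts H)" for xs k
    using that hg(2) by (auto simp: nlists_iff_nth)
  obtain S where S: "finite S" "card S = min_generators (id_Pol G) m" "generates_power (id_Pol G) m S"
    using min_generators_attained[OF fin] by blast
  have SG: "S \<subseteq> nlists m (verts G)" using S(3) by (simp add: generates_power_def)
  have op: "(\<lambda>xs. h (f (map g xs))) \<in> operations (id_Pol H) k"
    if f: "f \<in> operations (id_Pol G) k" for f k
  proof -
    have f1: "k \<ge> 1" "polymorphism G k f" "idempotent (verts G) k f"
      using f by (auto simp: operations_id_Pol)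
    have "polymorphism H k (\<lambda>xs. h (f (map g xs)))"
      unfolding polymorphism_def
    proof (intro conjI ballI impI)
      fix xs assume "xs \<in> nlists k (verts H)"
      then show "h (f (map g xs)) \<in> verts H"
        using f1(2) mapg gh(2) by (auto simp: polymorphism_def)
    next
      fix xs ys assume xy: "xs \<in> nlists k (verts H)" "ys \<in> nlists k (verts H)"
        and e: "\<forall>i<k. (xs ! i, ys ! i) \<in> edges H"
      have "(map g xs ! i, map g ys ! i) \<in> edges G" if "i < k" for i
        using xy e that hE[of "g (xs ! i)" "g (ys ! i)"] hg by (auto simp: nlists_iff_nth)
      then have "(f (map g xs), f (map g ys)) \<in> edges G"
        using f1(2) mapg xy unfolding polymorphism_def by blast
      moreover have "f (map g xs) \<in> verts G" "f (map g ys) \<in> verts G"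
        using f1(2) mapg xy unfolding polymorphism_def by blast+
      ultimately show "(h (f (map g xs)), h (f (map g ys))) \<in> edges H" using hE by blast
    qed
    moreover have "idempotent (verts H) k (\<lambda>xs. h (f (map g xs)))"
      using f1(3) hg by (simp add: idempotent_def)
    ultimately show ?thesis using f1(1) by (simp add: operations_id_Pol)
  qed
  have "generates_power (id_Pol H) m (map h ` S)"
    unfolding generates_power_def
  proof (intro conjI ballI)
    show "map h ` S \<subseteq> nlists m (universe (id_Pol H))"
      using SG gh(2) by (fastforce simp: nlists_iff_nth)
  next
    fix t assume "t \<in> nlists m (universe (id_Pol H))"
    then have t: "t \<in> nlists m (verts H)" by simp
    obtain k f ss where f: "f \<in> operations (id_Pol G) k" and ss: "ss \<in> nlists k S"
      and eq: "map g t = coordinatewise m f ss"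
      using S(3) mapg[OF t] by (auto simp: generates_power_def)
    have ss': "ss ! l \<in> nlists m (verts G)" if "l < k" for l
      using ss SG that by (auto simp: nlists_iff_nth[of _ k])
    have "t = coordinatewise m (\<lambda>xs. h (f (map g xs))) (map (map h) ss)"
    proof (rule nth_equalityI)
      fix j assume "j < length t"
      then have j: "j < m" using t by (simp add: nlists_iff_nth)
      have "map g (map (\<lambda>s. s ! j) (map (map h) ss)) = map (\<lambda>s. s ! j) ss"
      proof (rule nth_equalityI)
        fix l assume "l < length (map g (map (\<lambda>s. s ! j) (map (map h) ss)))"
        then have "l < k" "l < length ss" using ss by (auto simp: nlists_iff_nth)
        then show "map g (map (\<lambda>s. s ! j) (map (map h) ss)) ! l = map (\<lambda>s. s ! j) ss ! l"
          using ss'[of l] j gh(1) by (auto simp: nlists_iff_nth)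
      qed simp
      moreover have "map g t ! j = f (map (\<lambda>s. s ! j) ss)" using eq j by simp
      then have "g (t ! j) = f (map (\<lambda>s. s ! j) ss)" using j t by (simp add: nlists_iff_nth)
      moreover have "t ! j \<in> verts H" using t j by (simp add: nlists_iff_nth)
      ultimately show "t ! j = coordinatewise m (\<lambda>xs. h (f (map g xs))) (map (map h) ss) ! j"
        using j hg(1)[of "t ! j"] by (simp del: map_map)
    qed (use t in \<open>simp add: nlists_iff_nth\<close>)
    moreover have "map (map h) ss \<in> nlists k (map h ` S)"
      using ss by (auto simp: nlists_def)
    ultimately show "\<exists>k. \<exists>f\<in>operations (id_Pol H) k. \<exists>ss\<in>nlists k (map h ` S).
        t = coordinatewise m f ss"
      using op[OF f] by blast
  qed
  then have "min_generators (id_Pol H) m \<le> card (map h ` S)"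
    using S(1) by (intro min_generators_le) auto
  also have "\<dots> \<le> card S" using S(1) by (rule card_image_le)
  finally show ?thesis using S(2) by simp
qed

lemma min_generators_graph_iso:
  assumes iso: "graph_iso G H" and fin: "finite (verts H)"
  shows "min_generators (id_Pol G) = min_generators (id_Pol H)"
proof -
  have "finite (verts G)" using iso fin by (auto simp: graph_iso_def bij_betw_finite)
  then show ?thesis
    using min_generators_graph_iso_le[OF iso] min_generators_graph_iso_le[OF graph_iso_sym[OF iso] fin]
    by (intro ext le_antisym)
qed

subsection \<open>Walks in partially reflexive paths\<close>

text \<open>The edge relation of the \<open>k\<close>-th direct power of \<open>H\<close>; the
  \<open>k\<close>-ary polymorphisms are the homomorphisms from this power to
  \<open>H\<close>.\<close>

definition tuple_edges :: "'a graph \<Rightarrow> nat \<Rightarrow> ('a list \<times> 'a list) set" where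
  "tuple_edges H k = {(xs, ys). xs \<in> nlists k (verts H) \<and> ys \<in> nlists k (verts H) \<and>
     (\<forall>i<k. (xs ! i, ys ! i) \<in> edges H)}"

lemma relpow_tuple_edgesI:
  assumes E: "edges H \<subseteq> verts H \<times> verts H"
    and "xs \<in> nlists k (verts H)" "ys \<in> nlists k (verts H)"
    and "\<And>i. i < k \<Longrightarrow> (xs ! i, ys ! i) \<in> edges H ^^ h"
  shows "(xs, ys) \<in> tuple_edges H k ^^ h"
  using assms(2-)
proof (induction h arbitrary: xs)
  case 0
  then show ?case by (auto simp: nlists_iff_nth intro: nth_equalityI)
next
  case (Suc h)
  have "\<exists>z. (xs ! i, z) \<in> edges H \<and> (z, ys ! i) \<in> edges H ^^ h" if "i < k" for i
    using Suc.prems(3)[OF that] by (meson relpow_Suc_E2)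
  then obtain z where z: "\<And>i. i < k \<Longrightarrow> (xs ! i, z i) \<in> edges H"
    "\<And>i. i < k \<Longrightarrow> (z i, ys ! i) \<in> edges H ^^ h" by metis
  let ?zs = "map z [0..<k]"
  have zs: "?zs \<in> nlists k (verts H)" using z(1) E by (auto simp: nlists_iff_nth)
  have "(xs, ?zs) \<in> tuple_edges H k"
    using Suc.prems(1) z(1) zs by (simp add: tuple_edges_def)
  moreover have "(?zs, ys) \<in> tuple_edges H k ^^ h"
    using Suc.IH[OF zs Suc.prems(2)] z(2) by simp
  ultimately show ?case by (rule relpow_Suc_I2)
qed

lemma polymorphism_relpow:
  assumes "polymorphism H k f" "(xs, ys) \<in> tuple_edges H k ^^ h"
  shows "(f xs, f ys) \<in> edges H ^^ h"
  using assms(2)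
proof (induction h arbitrary: ys)
  case (Suc h)
  then obtain zs where zs: "(xs, zs) \<in> tuple_edges H k ^^ h" "(zs, ys) \<in> tuple_edges H k"
    by (meson relpow_Suc_E)
  have "(f zs, f ys) \<in> edges H"
    using assms(1) zs(2) by (auto simp: polymorphism_def tuple_edges_def)
  then show ?case using Suc.IH[OF zs(1)] by (rule relpow_Suc_I[rotated])
qed simp

text \<open>False outside the vertex range, so conditions on the absence of loops need no range
  restriction.\<close>

definition loop_at :: "bool list \<Rightarrow> nat \<Rightarrow> bool" where
  "loop_at \<beta> v \<longleftrightarrow> 1 \<le> v \<and> v \<le> length \<beta> \<and> \<beta> ! (v - 1)"

lemma verts_path_graph [simp]: "verts (path_graph \<beta>) = {1..length \<beta>}"
  by (simp add: path_graph_def)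

lemma edges_path_graph:
  "(x, y) \<in> edges (path_graph \<beta>) \<longleftrightarrow> x \<in> {1..length \<beta>} \<and> y \<in> {1..length \<beta>} \<and>
     (y = x + 1 \<or> x = y + 1 \<or> x = y \<and> loop_at \<beta> x)"
  by (auto simp: path_graph_def loop_at_def)

lemma edges_path_graph_subset: "edges (path_graph \<beta>) \<subseteq> verts (path_graph \<beta>) \<times> verts (path_graph \<beta>)"
  by (auto simp: edges_path_graph)

lemma loop_at_iff_edge: "loop_at \<beta> v \<longleftrightarrow> (v, v) \<in> edges (path_graph \<beta>)"
  by (auto simp: edges_path_graph loop_at_def)

lemma loop_atD: "loop_at \<beta> v \<Longrightarrow> v \<in> {1..length \<beta>}"
  by (simp add: loop_at_def)

lemma relpow_path_dist:
  "(x, y) \<in> edges (path_graph \<beta>) ^^ h \<Longrightarrow> x \<le> y + h \<and> y \<le> x + h"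
proof (induction h arbitrary: y)
  case (Suc h)
  then obtain z where "(x, z) \<in> edges (path_graph \<beta>) ^^ h" "(z, y) \<in> edges (path_graph \<beta>)"
    by (meson relpow_Suc_E)
  then show ?case using Suc.IH[of z] by (auto simp: edges_path_graph)
qed simp

text \<open>A walk ending in a loop can spend surplus steps there, so every length from the distance
  upwards is realised, whatever its parity.\<close>

lemma relpow_path_to_loop:
  assumes "loop_at \<beta> u" "x \<in> {1..length \<beta>}" "x \<le> u + h" "u \<le> x + h"
  shows "(x, u) \<in> edges (path_graph \<beta>) ^^ h"
  using assms(2-)
proof (induction h arbitrary: x)
  case (Suc h)
  note u = loop_atD[OF assms(1)]
  define y where "y = (if x < u then x + 1 else if u < x then x - 1 else x)"
  have "(x, y) \<in> edges (path_graph \<beta>)"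
    using Suc.prems u assms(1) by (auto simp: edges_path_graph y_def)
  moreover have "(y, u) \<in> edges (path_graph \<beta>) ^^ h"
    using Suc.prems u by (intro Suc.IH) (auto simp: y_def)
  ultimately show ?case by (rule relpow_Suc_I2)
qed simp

lemma relpow_path_from_loop:
  assumes "loop_at \<beta> u" "x \<in> {1..length \<beta>}" "x \<le> u + h" "u \<le> x + h"
  shows "(u, x) \<in> edges (path_graph \<beta>) ^^ h"
  using assms(2-)
proof (induction h arbitrary: x)
  case (Suc h)
  note u = loop_atD[OF assms(1)]
  define y where "y = (if x < u then x + 1 else if u < x then x - 1 else x)"
  have "(y, x) \<in> edges (path_graph \<beta>)"
    using Suc.prems u assms(1) by (auto simp: edges_path_graph y_def)
  moreover have "(u, y) \<in> edges (path_graph \<beta>) ^^ h"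
    using Suc.prems u by (intro Suc.IH) (auto simp: y_def)
  ultimately show ?case by (rule relpow_Suc_I[rotated])
qed simp

subsection \<open>Gaps and exponential growth\<close>

definition gap :: "bool list \<Rightarrow> nat \<Rightarrow> nat \<Rightarrow> bool" where
  "gap \<beta> P Q \<longleftrightarrow> loop_at \<beta> P \<and> loop_at \<beta> Q \<and> P + 2 \<le> Q \<and> (\<forall>v. P < v \<and> v < Q \<longrightarrow> \<not> loop_at \<beta> v)"

text \<open>Take the nearest loops on either side of \<open>v\<close>; as \<open>v\<close> is
  loopless and strictly between them, they are at least two apart.\<close>

lemma gap_around:
  assumes "\<not> loop_at \<beta> v" "loop_at \<beta> u" "u < v" "loop_at \<beta> w" "v < w"
  obtains P Q where "gap \<beta> P Q" "u \<le> P" "P < v" "v < Q" "Q \<le> w"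
proof -
  define P where "P = (GREATEST x. loop_at \<beta> x \<and> x < v)"
  define Q where "Q = (LEAST x. loop_at \<beta> x \<and> v < x)"
  have P: "loop_at \<beta> P \<and> P < v" unfolding P_def
    by (rule GreatestI_nat[where b = v]) (use assms in auto)
  have Pmax: "x \<le> P" if "loop_at \<beta> x" "x < v" for x
    unfolding P_def by (rule Greatest_le_nat[where b = v]) (use that in auto)
  have Q: "loop_at \<beta> Q \<and> v < Q" unfolding Q_def
    by (rule LeastI[where k = w]) (use assms in auto)
  have Qmin: "Q \<le> x" if "loop_at \<beta> x" "v < x" for x
    unfolding Q_def by (rule Least_le) (use that in auto)
  have "\<not> loop_at \<beta> x" if "P < x" "x < Q" for x
    using that Pmax[of x] Qmin[of x] assms(1) by (cases x v rule: linorder_cases) auto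
  then have "gap \<beta> P Q" using P Q by (auto simp: gap_def)
  then show ?thesis using that P Q Pmax Qmin assms by blast
qed

section \<open>Idempotent polymorphisms and gaps\<close>

locale path_operation =
  fixes \<beta> :: "bool list" and k :: nat and f :: "nat list \<Rightarrow> nat"
  assumes op: "f \<in> operations (id_Pol (path_graph \<beta>)) k"
begin

abbreviation V where "V \<equiv> {1..length \<beta>}"

abbreviation E where "E \<equiv> edges (path_graph \<beta>)"

lemma poly: "polymorphism (path_graph \<beta>) k f"
  using op by (simp add: operations_id_Pol)

lemma f_edge:
  assumes "xs \<in> nlists k V" "ys \<in> nlists k V" "\<And>j. j < k \<Longrightarrow> (xs ! j, ys ! j) \<in> E"
  shows "(f xs, f ys) \<in> E"
  using poly assms by (simp add: polymorphism_def)

lemma f_replicate: "a \<in> V \<Longrightarrow> f (replicate k a) = a"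
  using op by (simp add: operations_id_Pol idempotent_def)

text \<open>Walks of a common length \<open>h\<close> in all coordinates form a walk in the power,
  which \<open>f\<close> maps to a walk of length \<open>h\<close> in the path.\<close>

lemma f_dist:
  assumes "xs \<in> nlists k V" "ys \<in> nlists k V" "\<And>j. j < k \<Longrightarrow> (xs ! j, ys ! j) \<in> E ^^ h"
  shows "f xs \<le> f ys + h" "f ys \<le> f xs + h"
proof -
  have "(xs, ys) \<in> tuple_edges (path_graph \<beta>) k ^^ h"
    using assms by (intro relpow_tuple_edgesI edges_path_graph_subset) auto
  from relpow_path_dist[OF polymorphism_relpow[OF poly this]]
  show "f xs \<le> f ys + h" "f ys \<le> f xs + h" by auto
qed

lemma f_loop:
  assumes "xs \<in> nlists k V" "\<And>j. j < k \<Longrightarrow> loop_at \<beta> (xs ! j)"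
  shows "loop_at \<beta> (f xs)"
  using f_edge[OF assms(1) assms(1)] assms(2) by (simp add: loop_at_iff_edge)

text \<open>A discrete intermediate value argument: on tuples over \<open>P\<close> and
  \<open>Q\<close> the value is a loop in \<open>{P..Q}\<close>, hence \<open>P\<close> or
  \<open>Q\<close>, so when the entries change one by one it must jump at a single entry.\<close>

lemma gap_switch:
  assumes g: "gap \<beta> P Q"
  obtains i ys where "i < k" "ys \<in> nlists k V" "\<And>j. j < k \<Longrightarrow> loop_at \<beta> (ys ! j)"
    "\<And>v. v \<in> {P..Q} \<Longrightarrow> f (ys[i := v]) = v"
proof -
  have PQ: "loop_at \<beta> P" "loop_at \<beta> Q" "P + 2 \<le> Q" using g by (auto simp: gap_def)
  then have V: "P \<in> V" "Q \<in> V" by (auto dest: loop_atD)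
  define z where "z t = map (\<lambda>j. if j < t then Q else P) [0..<k]" for t
  have znth: "z t ! j = (if j < t then Q else P)" if "j < k" for t j
    using that by (simp add: z_def)
  have zV: "z t \<in> nlists k V" for t using V by (auto simp: nlists_iff_nth z_def)
  have zloop: "loop_at \<beta> (z t ! j)" if "j < k" for t j using that PQ by (simp add: z_def)
  have zPQ: "f (z t) = P \<or> f (z t) = Q" for t
  proof -
    have "f (z t) \<le> f (replicate k P) + (Q - P)"
      by (rule f_dist(1)[OF zV]) (use V PQ znth in \<open>auto simp: nlists_iff_nth intro!: relpow_path_to_loop\<close>)
    moreover have "f (replicate k Q) \<le> f (z t) + (Q - P)"
      by (rule f_dist(2)[OF zV]) (use V PQ znth in \<open>auto simp: nlists_iff_nth intro!: relpow_path_to_loop\<close>)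
    ultimately have "P \<le> f (z t)" "f (z t) \<le> Q" using V f_replicate PQ by auto
    moreover have "loop_at \<beta> (f (z t))" by (rule f_loop[OF zV zloop])
    ultimately show ?thesis using g unfolding gap_def by (metis le_neq_implies_less)
  qed
  have z0: "f (z 0) = P" and zk: "f (z k) = Q"
  proof -
    have "z 0 = replicate k P" "z k = replicate k Q"
      by (auto simp: z_def intro: nth_equalityI)
    then show "f (z 0) = P" "f (z k) = Q" using V f_replicate by auto
  qed
  have "\<exists>t<k. f (z t) = P \<and> f (z (Suc t)) = Q"
  proof (rule ccontr)
    assume *: "\<not> ?thesis"
    have "t \<le> k \<Longrightarrow> f (z t) = P" for t
    proof (induction t)
      case (Suc t)
      then show ?case using * zPQ[of "Suc t"] by auto
    qed (rule z0)
    then show False using zk PQ by auto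
  qed
  then obtain t where t: "t < k" "f (z t) = P" "f (z (Suc t)) = Q" by blast
  \<comment> \<open>This tuple is \<open>v - P\<close> steps from \<open>z t\<close> and
    \<open>Q - v\<close> steps from \<open>z (Suc t)\<close>, the other entries waiting at loops.
    With the values \<open>P\<close> and \<open>Q\<close> there, only \<open>v\<close> is
    left.\<close>
  have "f ((z t)[t := v]) = v" if v: "v \<in> {P..Q}" for v
  proof -
    have vV: "v \<in> V" using v V by auto
    have upd: "(z t)[t := v] \<in> nlists k V" using zV vV by blast
    have nth: "(z t)[t := v] ! j = (if j = t then v else if j < t then Q else P)" if "j < k" for j
      using that by (auto simp: nth_list_update z_def)
    have "f ((z t)[t := v]) \<le> f (z t) + (v - P)"
      by (rule f_dist(1)[OF upd zV])
        (use V vV v PQ znth nth in \<open>auto intro!: relpow_path_to_loop\<close>)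
    moreover have "f (z (Suc t)) \<le> f ((z t)[t := v]) + (Q - v)"
      by (rule f_dist(2)[OF upd zV])
        (use V vV v PQ znth nth in \<open>auto intro!: relpow_path_to_loop\<close>)
    ultimately show ?thesis using t v by auto
  qed
  then show ?thesis using that[OF t(1) zV zloop] by blast
qed

text \<open>The value at a vertex of the gap is pinned from both sides by the values at its two
  neighbours, so it does not change when the other entries move along edges.\<close>

lemma gap_step:
  assumes g: "gap \<beta> P Q" and i: "i < k" and e: "(ys, zs) \<in> tuple_edges (path_graph \<beta>) k"
    and ys: "\<And>v. v \<in> {P..Q} \<Longrightarrow> f (ys[i := v]) = v" and v: "v \<in> {P..Q}"
  shows "f (zs[i := v]) = v"
proof -
  have PQ: "loop_at \<beta> P" "loop_at \<beta> Q" "P + 2 \<le> Q" using g by (auto simp: gap_def)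
  then have V: "P \<in> V" "Q \<in> V" by (auto dest: loop_atD)
  have len: "length ys = k" "length zs = k" "ys \<in> nlists k V" "zs \<in> nlists k V"
    using e by (auto simp: tuple_edges_def nlists_iff_nth)
  have adj: "(u, f (zs[i := v])) \<in> E" if "u \<in> {P..Q}" "(u, v) \<in> E" for u
  proof -
    have "(f (ys[i := u]), f (zs[i := v])) \<in> E"
    proof (rule f_edge)
      have uv: "u \<in> V" "v \<in> V" using that(2) by (auto simp: edges_path_graph)
      show "ys[i := u] \<in> nlists k V" "zs[i := v] \<in> nlists k V"
        using len(3,4) uv by blast+
      show "(ys[i := u] ! j, zs[i := v] ! j) \<in> E" if "j < k" for j
        using e that len i \<open>(u, v) \<in> E\<close> by (auto simp: tuple_edges_def nth_list_update)
    qed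
    then show ?thesis using ys[OF that(1)] by simp
  qed
  consider "v = P" | "v = Q" | "P < v" "v < Q" using v by fastforce
  then show ?thesis
  proof cases
    case 1
    \<comment> \<open>An end of the gap has only one neighbour inside it. Its own loop takes the
      place of the other, and since \<open>P + 1\<close> has no loop, the value cannot be
      \<open>P + 1\<close>.\<close>
    have "(P, f (zs[i := v])) \<in> E" "(P + 1, f (zs[i := v])) \<in> E"
      using adj[of P] adj[of "P + 1"] 1 PQ V by (auto simp: edges_path_graph)
    moreover have "\<not> loop_at \<beta> (P + 1)" using g by (auto simp: gap_def)
    ultimately show ?thesis using 1 by (auto simp: edges_path_graph)
  next
    case 2
    have "(Q, f (zs[i := v])) \<in> E" "(Q - 1, f (zs[i := v])) \<in> E"
      using adj[of Q] adj[of "Q - 1"] 2 PQ V by (auto simp: edges_path_graph)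
    moreover have "\<not> loop_at \<beta> (Q - 1)" using g by (auto simp: gap_def)
    ultimately show ?thesis using 2 PQ by (auto simp: edges_path_graph)
  next
    case 3
    have "(v - 1, v) \<in> E" "(v + 1, v) \<in> E" "v - 1 \<in> {P..Q}" "v + 1 \<in> {P..Q}"
      using 3 V by (auto simp: edges_path_graph)
    then have "(v - 1, f (zs[i := v])) \<in> E" "(v + 1, f (zs[i := v])) \<in> E"
      using adj[of "v - 1"] adj[of "v + 1"] by blast+
    then show ?thesis using 3 by (auto simp: edges_path_graph)
  qed
qed

text \<open>The tuple \<open>ys\<close> from \<open>gap_switch\<close> consists of loops, so walks
  of the common length \<open>length \<beta>\<close> lead from it to every tuple;
  \<open>gap_step\<close> carries the behaviour at entry \<open>i\<close> along them.\<close>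

lemma gap_projection:
  assumes g: "gap \<beta> P Q"
  obtains i where "i < k" "\<And>xs. xs \<in> nlists k V \<Longrightarrow> xs ! i \<in> {P..Q} \<Longrightarrow> f xs = xs ! i"
proof -
  obtain i ys where i: "i < k" and ys: "ys \<in> nlists k V" "\<And>j. j < k \<Longrightarrow> loop_at \<beta> (ys ! j)"
    "\<And>v. v \<in> {P..Q} \<Longrightarrow> f (ys[i := v]) = v"
    using gap_switch[OF g] by blast
  have step: "f (zs[i := v]) = v"
    if "(ys, zs) \<in> tuple_edges (path_graph \<beta>) k ^^ h" "v \<in> {P..Q}" for h zs v
    using that
  proof (induction h arbitrary: zs v)
    case 0
    then show ?case using ys(3) by simp
  next
    case (Suc h)
    then obtain ws where ws: "(ys, ws) \<in> tuple_edges (path_graph \<beta>) k ^^ h"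
      "(ws, zs) \<in> tuple_edges (path_graph \<beta>) k" by (meson relpow_Suc_E)
    show ?case by (rule gap_step[OF g i ws(2) Suc.IH[OF ws(1)] Suc.prems(2)])
  qed
  have "f xs = xs ! i" if xs: "xs \<in> nlists k V" "xs ! i \<in> {P..Q}" for xs
  proof -
    have "(ys, xs) \<in> tuple_edges (path_graph \<beta>) k ^^ length \<beta>"
    proof (rule relpow_tuple_edgesI[OF edges_path_graph_subset])
      fix j assume j: "j < k"
      have "ys ! j \<in> V" "xs ! j \<in> V" using ys(1) xs(1) j by (auto simp: nlists_iff_nth)
      then show "(ys ! j, xs ! j) \<in> E ^^ length \<beta>"
        by (intro relpow_path_from_loop ys(2)[OF j]) auto
    qed (use ys xs in auto)
    from step[OF this xs(2)] show ?thesis by simp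
  qed
  then show ?thesis using that i by blast
qed

text \<open>Two gaps with different coordinates would conflict: on a tuple that is constantly
  \<open>P\<^sub>0\<close> except for an end \<open>v\<close> of the other gap at entry
  \<open>j\<close>, the value would be both \<open>P\<^sub>0\<close> and \<open>v\<close>, for
  \<open>v = P\<close> and for \<open>v = Q\<close>.\<close>

lemma common_gap_projection:
  assumes g0: "gap \<beta> P\<^sub>0 Q\<^sub>0"
  obtains i where "i < k"
    "\<And>P Q xs. gap \<beta> P Q \<Longrightarrow> xs \<in> nlists k V \<Longrightarrow> xs ! i \<in> {P..Q} \<Longrightarrow> f xs = xs ! i"
proof -
  obtain i where i: "i < k" "\<And>xs. xs \<in> nlists k V \<Longrightarrow> xs ! i \<in> {P\<^sub>0..Q\<^sub>0} \<Longrightarrow> f xs = xs ! i"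
    using gap_projection[OF g0] by blast
  have P0: "P\<^sub>0 \<in> V" "P\<^sub>0 \<le> Q\<^sub>0" using g0 by (auto simp: gap_def dest: loop_atD)
  have "f xs = xs ! i"
    if g: "gap \<beta> P Q" and xs: "xs \<in> nlists k V" "xs ! i \<in> {P..Q}" for P Q xs
  proof -
    obtain j where j: "j < k" "\<And>xs. xs \<in> nlists k V \<Longrightarrow> xs ! j \<in> {P..Q} \<Longrightarrow> f xs = xs ! j"
      using gap_projection[OF g] by blast
    have PQ: "P \<in> V" "Q \<in> V" "P < Q" using g by (auto simp: gap_def dest: loop_atD)
    have "j = i"
    proof (rule ccontr)
      assume ne: "j \<noteq> i"
      have "v = P\<^sub>0" if v: "v \<in> {P, Q}" for v
      proof -
        let ?ys = "(replicate k P\<^sub>0)[j := v]"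
        have ys: "?ys \<in> nlists k V" using v PQ P0 by auto
        have "?ys ! i = P\<^sub>0" "?ys ! j = v" using ne i(1) j(1) by auto
        then show ?thesis using i(2)[OF ys] j(2)[OF ys] v P0 PQ by auto
      qed
      then show False using PQ(3) by auto
    qed
    then show ?thesis using j(2)[OF xs(1)] xs(2) by simp
  qed
  then show ?thesis using that i(1) by blast
qed

text \<open>Induction on the distance of entry \<open>i\<close> from \<open>P\<close>. If the next
  vertex is a loop, moving only entry \<open>i\<close> there is an edge step, as the other entries
  stay on loops; the value moves by at most one and, being a loop, cannot be \<open>P + 1\<close>.
  Otherwise entry \<open>i\<close> is the left end of a gap and projection applies.\<close>

lemma loops_stay_below:
  assumes i: "i < k"
    and proj: "\<And>P Q xs. gap \<beta> P Q \<Longrightarrow> xs \<in> nlists k V \<Longrightarrow> xs ! i \<in> {P..Q} \<Longrightarrow> f xs = xs ! i"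
    and g: "gap \<beta> P Q"
    and "xs \<in> nlists k V" "\<And>j. j < k \<Longrightarrow> loop_at \<beta> (xs ! j)" "xs ! i \<le> P"
  shows "f xs \<le> P"
  using assms(4-)
proof (induction "P - xs ! i" arbitrary: xs rule: less_induct)
  case less
  have gP: "loop_at \<beta> P" "\<not> loop_at \<beta> (P + 1)" "P < Q" using g by (auto simp: gap_def)
  let ?u = "xs ! i"
  consider "?u = P" | "?u < P" "loop_at \<beta> (?u + 1)" | "?u < P" "\<not> loop_at \<beta> (?u + 1)"
    using less.prems(3) by linarith
  then show ?case
  proof cases
    case 1
    then show ?thesis using proj[OF g less.prems(1)] gP by auto
  next
    case 2
    let ?ys = "xs[i := ?u + 1]"
    have len: "length xs = k" using less.prems(1) by (simp add: nlists_iff_nth)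
    have ys: "?ys \<in> nlists k V" using less.prems(1) loop_atD[OF 2(2)] by blast
    have ysl: "loop_at \<beta> (?ys ! j)" if "j < k" for j
      using that 2 less.prems(2) len by (cases "j = i") auto
    have "f ?ys \<le> P"
      using 2 i len ys ysl by (intro less.hyps) auto
    moreover have "(f xs, f ?ys) \<in> E"
    proof (rule f_edge[OF less.prems(1) ys])
      fix j assume j: "j < k"
      show "(xs ! j, ?ys ! j) \<in> E"
        using j len less.prems(2)[OF j] loop_atD[OF less.prems(2)[OF j]] loop_atD[OF 2(2)]
        by (cases "j = i") (auto simp: edges_path_graph)
    qed
    ultimately have "f xs \<le> P + 1" by (auto simp: edges_path_graph)
    moreover have "f xs \<noteq> P + 1" using f_loop[OF less.prems(1,2)] gP(2) by auto
    ultimately show ?thesis by simp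
  next
    case 3
    have "?u + 1 \<noteq> P" using 3 gP by auto
    then have "?u < ?u + 1" "?u + 1 < P" using 3(1) by auto
    from gap_around[OF 3(2) less.prems(2)[OF i] this(1) gP(1) this(2)] obtain P' Q'
      where "gap \<beta> P' Q'" "?u \<le> P'" "P' < ?u + 1" by blast
    then show ?thesis using proj[of P' Q' xs] less.prems 3 by (auto simp: gap_def)
  qed
qed

text \<open>Mirror image of \<open>loops_stay_below\<close>, with entry \<open>i\<close> moving left
  towards \<open>Q\<close>.\<close>

lemma loops_stay_above:
  assumes i: "i < k"
    and proj: "\<And>P Q xs. gap \<beta> P Q \<Longrightarrow> xs \<in> nlists k V \<Longrightarrow> xs ! i \<in> {P..Q} \<Longrightarrow> f xs = xs ! i"
    and g: "gap \<beta> P Q"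
    and "xs \<in> nlists k V" "\<And>j. j < k \<Longrightarrow> loop_at \<beta> (xs ! j)" "Q \<le> xs ! i"
  shows "Q \<le> f xs"
  using assms(4-)
proof (induction "xs ! i - Q" arbitrary: xs rule: less_induct)
  case less
  have gQ: "loop_at \<beta> Q" "\<not> loop_at \<beta> (Q - 1)" "P < Q" using g by (auto simp: gap_def)
  let ?u = "xs ! i"
  consider "?u = Q" | "Q < ?u" "loop_at \<beta> (?u - 1)" | "Q < ?u" "\<not> loop_at \<beta> (?u - 1)"
    using less.prems(3) by linarith
  then show ?case
  proof cases
    case 1
    then show ?thesis using proj[OF g less.prems(1)] gQ by auto
  next
    case 2
    let ?ys = "xs[i := ?u - 1]"
    have len: "length xs = k" using less.prems(1) by (simp add: nlists_iff_nth)
    have ys: "?ys \<in> nlists k V" using less.prems(1) loop_atD[OF 2(2)] by blast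
    have ysl: "loop_at \<beta> (?ys ! j)" if "j < k" for j
      using that 2 less.prems(2) len by (cases "j = i") auto
    have "Q \<le> f ?ys"
      using 2 i len ys ysl by (intro less.hyps) auto
    moreover have "(f xs, f ?ys) \<in> E"
    proof (rule f_edge[OF less.prems(1) ys])
      fix j assume j: "j < k"
      show "(xs ! j, ?ys ! j) \<in> E"
        using j len less.prems(2)[OF j] loop_atD[OF less.prems(2)[OF j]] loop_atD[OF 2(2)] 2(1)
        by (cases "j = i") (auto simp: edges_path_graph)
    qed
    ultimately have "Q \<le> f xs + 1" by (auto simp: edges_path_graph)
    moreover have "f xs \<noteq> Q - 1" using f_loop[OF less.prems(1,2)] gQ(2) by auto
    ultimately show ?thesis by simp
  next
    case 3
    have "?u - 1 \<noteq> Q" using 3 gQ by auto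
    then have "Q < ?u - 1" "?u - 1 < ?u" using 3(1) by auto
    from gap_around[OF 3(2) gQ(1) this(1) less.prems(2)[OF i] this(2)] obtain P' Q'
      where "gap \<beta> P' Q'" "?u - 1 < Q'" "Q' \<le> ?u" by blast
    then show ?thesis using proj[of P' Q' xs] less.prems 3 by (auto simp: gap_def)
  qed
qed

lemma gap_separates:
  assumes g: "gap \<beta> P Q" and h: "P + h < length \<beta>" "h + 1 < Q"
    and cover: "\<And>v. v \<in> V \<Longrightarrow> \<exists>u. loop_at \<beta> u \<and> u \<le> v + h \<and> v \<le> u + h"
  shows "\<exists>i<k. \<forall>xs\<in>nlists k V.
    (xs ! i \<in> {..P} \<longrightarrow> f xs \<noteq> length \<beta>) \<and> (xs ! i \<notin> {..P} \<longrightarrow> f xs \<noteq> 1)"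
proof -
  obtain i where i: "i < k" and
    proj: "\<And>P Q xs. gap \<beta> P Q \<Longrightarrow> xs \<in> nlists k V \<Longrightarrow> xs ! i \<in> {P..Q} \<Longrightarrow> f xs = xs ! i"
    using common_gap_projection[OF g] by blast
  have PQ: "loop_at \<beta> P" "loop_at \<beta> Q" "P < Q" using g by (auto simp: gap_def)
  \<comment> \<open>Every entry is moved to a loop within \<open>h\<close> steps, entry
    \<open>i\<close> to a prescribed one; the value changes by at most \<open>h\<close>.\<close>
  have near: "\<exists>zs\<in>nlists k V. (\<forall>j<k. loop_at \<beta> (zs ! j)) \<and> zs ! i = w \<and>
      f xs \<le> f zs + h \<and> f zs \<le> f xs + h"
    if xs: "xs \<in> nlists k V" and w: "loop_at \<beta> w" "w \<le> xs ! i + h" "xs ! i \<le> w + h" for xs w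
  proof -
    have xsV: "xs ! j \<in> V" if "j < k" for j using xs that by (auto simp: nlists_iff_nth)
    have "\<exists>u. loop_at \<beta> u \<and> u \<le> xs ! j + h \<and> xs ! j \<le> u + h \<and> (j = i \<longrightarrow> u = w)" if "j < k" for j
      using cover[OF xsV[OF that]] w by (cases "j = i") auto
    then obtain u where u: "\<And>j. j < k \<Longrightarrow> loop_at \<beta> (u j)" "\<And>j. j < k \<Longrightarrow> u j \<le> xs ! j + h"
      "\<And>j. j < k \<Longrightarrow> xs ! j \<le> u j + h" "i < k \<Longrightarrow> u i = w" by metis
    let ?zs = "map u [0..<k]"
    have zs: "?zs \<in> nlists k V" using loop_atD[OF u(1)] by (auto simp: nlists_iff_nth)
    have "(xs ! j, ?zs ! j) \<in> E ^^ h" if "j < k" for j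
      using that u xsV by (auto intro!: relpow_path_to_loop)
    from f_dist[OF xs zs this] show ?thesis
      using zs u(1,4) i by (intro bexI[of _ ?zs]) auto
  qed
  have "f xs \<noteq> length \<beta>" if xs: "xs \<in> nlists k V" "xs ! i \<le> P" for xs
  proof -
    have "xs ! i \<in> V" using xs(1) i by (simp add: nlists_iff_nth)
    then obtain u where u: "loop_at \<beta> u" "u \<le> xs ! i + h" "xs ! i \<le> u + h"
      using cover by blast
    \<comment> \<open>If \<open>u\<close> lies beyond \<open>P\<close>, then \<open>P\<close> is
      between entry \<open>i\<close> and \<open>u\<close>, so it is still within \<open>h\<close>
      and on the correct side of the gap.\<close>
    define w where "w = min u P"
    have w: "loop_at \<beta> w" "w \<le> xs ! i + h" "xs ! i \<le> w + h" "w \<le> P"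
      using u PQ xs(2) by (auto simp: w_def min_def)
    from near[OF xs(1) w(1-3)] obtain zs where zs: "zs \<in> nlists k V" "\<forall>j<k. loop_at \<beta> (zs ! j)"
      "zs ! i = w" "f xs \<le> f zs + h" by blast
    have "f zs \<le> P" by (rule loops_stay_below[OF i proj g]) (use zs w in auto)
    then show ?thesis using zs(4) h(1) by simp
  qed
  moreover have "f xs \<noteq> 1" if xs: "xs \<in> nlists k V" "P < xs ! i" for xs
  proof (cases "xs ! i \<le> Q")
    case True
    then have "f xs = xs ! i" using proj[OF g xs(1)] xs(2) by simp
    then show ?thesis using xs(2) loop_atD[OF PQ(1)] by simp
  next
    case False
    have "xs ! i \<in> V" using xs(1) i by (simp add: nlists_iff_nth)
    then obtain u where u: "loop_at \<beta> u" "u \<le> xs ! i + h" "xs ! i \<le> u + h"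
      using cover by blast
    define w where "w = max u Q"
    have w: "loop_at \<beta> w" "w \<le> xs ! i + h" "xs ! i \<le> w + h" "Q \<le> w"
      using u PQ False by (auto simp: w_def max_def)
    from near[OF xs(1) w(1-3)] obtain zs where zs: "zs \<in> nlists k V" "\<forall>j<k. loop_at \<beta> (zs ! j)"
      "zs ! i = w" "f zs \<le> f xs + h" by blast
    have "Q \<le> f zs" by (rule loops_stay_above[OF i proj g]) (use zs w in auto)
    then show ?thesis using zs(4) h(2) by simp
  qed
  ultimately show ?thesis using i by auto
qed

end

section \<open>Choosing a gap by the covering radius of the loops\<close>

text \<open>Choose a gap next to a vertex that realises the covering radius \<open>h\<close> of the loops; if that
  vertex is an end of the path, the hypotheses provide a gap far enough from both ends.\<close>

lemma separating_gap_exists: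
  fixes \<beta> :: "bool list"
  defines "n \<equiv> length \<beta>"
  assumes N1: "\<And>a. a \<le> n \<Longrightarrow> (\<And>v. v \<le> a \<Longrightarrow> \<not> loop_at \<beta> v) \<Longrightarrow>
      \<exists>v. a < v \<and> v + a \<le> n \<and> \<not> loop_at \<beta> v"
    and N2: "\<And>a. a \<le> n \<Longrightarrow> (\<And>v. n < v + a \<Longrightarrow> \<not> loop_at \<beta> v) \<Longrightarrow>
      \<exists>v. a < v \<and> v + a \<le> n \<and> \<not> loop_at \<beta> v"
  obtains P Q h where "gap \<beta> P Q" "P + h < n" "h + 1 < Q"
    "\<And>v. v \<in> {1..n} \<Longrightarrow> \<exists>u. loop_at \<beta> u \<and> u \<le> v + h \<and> v \<le> u + h"
proof -
  let ?C = "\<lambda>h. \<forall>v\<in>{1..n}. \<exists>u. loop_at \<beta> u \<and> u \<le> v + h \<and> v \<le> u + h"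
  have inV: "1 \<le> v" "v \<le> n" if "loop_at \<beta> v" for v using that by (auto simp: n_def loop_at_def)
  \<comment> \<open>For \<open>a = n\<close> no \<open>v\<close> can satisfy the conclusion of
    \<open>N1\<close>, so some vertex has a loop.\<close>
  have "\<exists>u. loop_at \<beta> u" using N1[of n] by fastforce
  then obtain u\<^sub>0 where u0: "loop_at \<beta> u\<^sub>0" by blast
  have "?C n" using u0 inV[OF u0] by (intro ballI exI[of _ u\<^sub>0]) auto
  define h where "h = (LEAST h. ?C h)"
  have Ch: "?C h" unfolding h_def by (rule LeastI) (rule \<open>?C n\<close>)
  have h0: "h > 0"
  proof (rule ccontr)
    assume "\<not> h > 0"
    then have "loop_at \<beta> v" if "v \<in> {1..n}" for v
      using bspec[OF Ch that] by (auto dest: le_antisym)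
    then show False using N1[of 0] by (auto simp: loop_at_def n_def)
  qed
  then have "\<not> ?C (h - 1)" unfolding h_def using not_less_Least[of "h - 1" ?C] by (auto simp: h_def)
  \<comment> \<open>Minimality of \<open>h\<close> gives a vertex \<open>v\<close> with no loop
    closer than \<open>h\<close>.\<close>
  then obtain v where v: "v \<in> {1..n}"
    and far: "\<And>u. loop_at \<beta> u \<Longrightarrow> \<not> (u \<le> v + (h - 1) \<and> v \<le> u + (h - 1))" by blast
  have far': "v + h \<le> u \<or> u + h \<le> v" if "loop_at \<beta> u" for u
    using far[OF that] h0 by auto
  have "\<exists>P Q. gap \<beta> P Q \<and> P + h < n \<and> h + 1 < Q"
  proof -
    consider (mid) u w where "loop_at \<beta> u" "u < v" "loop_at \<beta> w" "v < w"
      | (left) "\<And>u. loop_at \<beta> u \<Longrightarrow> v + h \<le> u" | (right) "\<And>u. loop_at \<beta> u \<Longrightarrow> u + h \<le> v"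
      using far' h0 by (metis add.commute le_add1 le_neq_implies_less le_trans
          less_add_same_cancel2 not_le)
    then show ?thesis
    proof cases
      case mid
      have "\<not> loop_at \<beta> v" using far'[of v] h0 by auto
      from gap_around[OF this mid] obtain P Q where PQ: "gap \<beta> P Q" "P < v" "v < Q" by blast
      then have "loop_at \<beta> P" "loop_at \<beta> Q" by (auto simp: gap_def)
      \<comment> \<open>The bounds follow from \<open>P + h \<le> v < Q \<le> n\<close> and
        \<open>h + 1 \<le> h + P < h + v \<le> Q\<close>.\<close>
      then have "P + h \<le> v" "v + h \<le> Q" using far'[of P] far'[of Q] PQ by auto
      then show ?thesis using PQ v inV[OF \<open>loop_at \<beta> P\<close>] inV[OF \<open>loop_at \<beta> Q\<close>]
        by (intro exI[of _ P] exI[of _ Q]) auto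
    next
      case left
      have "1 \<in> {1..n}" using v by auto
      then obtain p where p: "loop_at \<beta> p" "p \<le> 1 + h" using Ch by blast
      \<comment> \<open>All loops are at least \<open>v + h\<close>, and vertex 1 has one that is at
        most \<open>1 + h\<close>. So the first loop is exactly \<open>1 + h\<close>, and
        \<open>N1\<close> applies with \<open>a = h\<close>.\<close>
      then have p1: "p = 1 + h" using left[OF p(1)] v by auto
      have "\<not> loop_at \<beta> u" if "u \<le> h" for u using left[of u] v that by auto
      with N1[of h] inV[OF p(1)] p1 obtain w where w: "h < w" "w + h \<le> n" "\<not> loop_at \<beta> w" by auto
      have pw: "p < w" using w p p1 by (cases "p = w") auto
      show ?thesis
      proof (cases "\<exists>q. loop_at \<beta> q \<and> w < q")
        case True
        then obtain q where "loop_at \<beta> q" "w < q" by blast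
        from gap_around[OF w(3) p(1) pw this] obtain P Q where "gap \<beta> P Q" "P < w" "w < Q" by blast
        then show ?thesis using w pw by (intro exI[of _ P] exI[of _ Q]) auto
      next
        case False
        \<comment> \<open>All loops lie left of \<open>w\<close>, so \<open>w + h \<le> n\<close>
          makes the loopless tail after the last loop \<open>q\<close> longer than \<open>h\<close>.
          Applying \<open>N2\<close> to this tail gives a loopless vertex between the loops
          \<open>p\<close> and \<open>q\<close>.\<close>
        define q where "q = (GREATEST x. loop_at \<beta> x)"
        have q: "loop_at \<beta> q" unfolding q_def
          by (rule GreatestI_nat[where b = n]) (use p inV in auto)
        have qmax: "x \<le> q" if "loop_at \<beta> x" for x
          unfolding q_def by (rule Greatest_le_nat[where b = n]) (use that inV in auto)
        have qw: "q < w" using False q w(3) by (metis linorder_neqE_nat)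
        have "\<not> loop_at \<beta> u" if "n < u + (n - q)" for u using qmax[of u] that inV[OF q] by auto
        with N2[of "n - q"] obtain w' where w': "n - q < w'" "w' + (n - q) \<le> n" "\<not> loop_at \<beta> w'"
          by auto
        have "w' \<noteq> q" using w'(3) q by auto
        then have "p < w'" "w' < q" using w'(1,2) p1 qw w(2) inV[OF q] by auto
        from gap_around[OF w'(3) p(1) this(1) q this(2)]
        obtain P Q where "gap \<beta> P Q" "P < w'" "w' < Q" by blast
        then show ?thesis using w' w qw by (intro exI[of _ P] exI[of _ Q]) auto
      qed
    next
      case right
      \<comment> \<open>Mirror image of the previous case, with \<open>N1\<close> and
        \<open>N2\<close> exchanged.\<close>
      have "n \<in> {1..n}" using v by auto
      then obtain q where q: "loop_at \<beta> q" "n \<le> q + h" using Ch by blast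
      then have q1: "q + h = n" using right[OF q(1)] v by auto
      have "\<not> loop_at \<beta> u" if "n < u + h" for u using right[of u] v that by auto
      with N2[of h] q1 obtain w where w: "h < w" "w + h \<le> n" "\<not> loop_at \<beta> w" by auto
      have wq: "w < q" using w q q1 by (cases "q = w") auto
      show ?thesis
      proof (cases "\<exists>p. loop_at \<beta> p \<and> p < w")
        case True
        then obtain p where "loop_at \<beta> p" "p < w" by blast
        from gap_around[OF w(3) this q(1) wq] obtain P Q where "gap \<beta> P Q" "P < w" "w < Q" by blast
        then show ?thesis using w wq by (intro exI[of _ P] exI[of _ Q]) auto
      next
        case False
        define p where "p = (LEAST x. loop_at \<beta> x)"
        have p: "loop_at \<beta> p" unfolding p_def using q(1) by (rule LeastI)
        have pmin: "p \<le> x" if "loop_at \<beta> x" for x unfolding p_def using that by (rule Least_le)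
        have wp: "w < p" using False p w(3) by (metis linorder_neqE_nat)
        have "p - 1 \<le> n" "\<And>u. u \<le> p - 1 \<Longrightarrow> \<not> loop_at \<beta> u"
          using inV[OF p] pmin wp by force+
        from N1[OF this] obtain w'
          where w': "p - 1 < w'" "w' + (p - 1) \<le> n" "\<not> loop_at \<beta> w'" by blast
        have "p < w'" using w' p by (cases "p = w'") auto
        moreover have "w' < q" using w' q1 wp w by auto
        ultimately obtain P Q where "gap \<beta> P Q" "P < w'" "w' < Q"
          using gap_around[OF w'(3) p _ q(1)] by blast
        then show ?thesis using w' w wp by (intro exI[of _ P] exI[of _ Q]) auto
      qed
    qed
  qed
  then show ?thesis using that Ch by blast
qed

text \<open>If the \<open>a\<close> leading zeros cover half of the word, it has the second form;
  otherwise the ones in between are a nonempty block and give the first. The contrapositive supplies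
  \<open>N1\<close> and, for the reversed word, \<open>N2\<close> in
  \<open>separating_gap_exists\<close>.\<close>

lemma quasi_loop_connected_wordI:
  assumes a: "a \<le> length \<beta>" and zeros: "\<And>v. v \<le> a \<Longrightarrow> \<not> loop_at \<beta> v"
    and ones: "\<And>v. a < v \<Longrightarrow> v + a \<le> length \<beta> \<Longrightarrow> loop_at \<beta> v"
  shows "quasi_loop_connected_word \<beta>"
proof -
  have z: "\<not> \<beta> ! j" if "j < a" for j
    using zeros[of "Suc j"] that a by (auto simp: loop_at_def)
  have o: "\<beta> ! j" if "a \<le> j" "j + a < length \<beta>" for j
    using ones[of "Suc j"] that by (auto simp: loop_at_def)
  show ?thesis
  proof (cases "length \<beta> \<le> 2 * a")
    case True
    \<comment> \<open>Rounding up makes the remaining part as long as the zeros or one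
      shorter.\<close>
    define b where "b = (length \<beta> + 1) div 2"
    have b: "b \<le> a" "b \<le> length \<beta>" using True by (auto simp: b_def)
    have "\<beta> = replicate b False @ drop b \<beta>"
    proof (rule nth_equalityI)
      fix j assume "j < length \<beta>"
      then show "\<beta> ! j = (replicate b False @ drop b \<beta>) ! j"
        using z[of j] b by (cases "j < b") (auto simp: nth_append)
    qed (use b in simp)
    moreover have "length (drop b \<beta>) = b \<or> length (drop b \<beta>) + 1 = b"
      unfolding b_def by simp linarith
    ultimately show ?thesis unfolding quasi_loop_connected_word_def by blast
  next
    case False
    let ?c = "length \<beta> - 2 * a"
    have "\<beta> = replicate a False @ replicate ?c True @ drop (length \<beta> - a) \<beta>"
    proof (rule nth_equalityI)
      fix j assume "j < length \<beta>"
      then show "\<beta> ! j = (replicate a False @ replicate ?c True @ drop (length \<beta> - a) \<beta>) ! j"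
        using z[of j] o[of j] False
        by (cases "j < a"; cases "j + a < length \<beta>") (auto simp: nth_append)
    qed (use False in simp)
    moreover have "?c > 0" "length (drop (length \<beta> - a) \<beta>) = a" using False by auto
    ultimately show ?thesis unfolding quasi_loop_connected_word_def by blast
  qed
qed

section \<open>Reversed words and exponential growth\<close>

lemma loop_at_rev: "loop_at (rev \<beta>) v \<longleftrightarrow> v \<in> {1..length \<beta>} \<and> loop_at \<beta> (length \<beta> + 1 - v)"
  by (auto simp: loop_at_def rev_nth Suc_diff_le)

lemma graph_iso_path_graph_rev: "graph_iso (path_graph \<beta>) (path_graph (rev \<beta>))"
  unfolding graph_iso_def
proof (intro exI[of _ "\<lambda>v. length \<beta> + 1 - v"] conjI ballI)
  show "bij_betw (\<lambda>v. length \<beta> + 1 - v) (verts (path_graph \<beta>)) (verts (path_graph (rev \<beta>)))"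
    by (rule bij_betw_byWitness[where f' = "\<lambda>v. length \<beta> + 1 - v"]) auto
  show "(x, y) \<in> edges (path_graph \<beta>) \<longleftrightarrow>
      (length \<beta> + 1 - x, length \<beta> + 1 - y) \<in> edges (path_graph (rev \<beta>))"
    if "x \<in> verts (path_graph \<beta>)" "y \<in> verts (path_graph \<beta>)" for x y
    using that by (auto simp: edges_path_graph loop_at_rev)
qed

lemma EGP_path_graph:
  assumes "\<not> quasi_loop_connected_word \<beta>" "\<not> quasi_loop_connected_word (rev \<beta>)"
  shows "EGP (id_Pol (path_graph \<beta>))"
proof -
  have N1: "\<exists>v. a < v \<and> v + a \<le> length \<beta> \<and> \<not> loop_at \<beta> v"
    if "a \<le> length \<beta>" "\<And>v. v \<le> a \<Longrightarrow> \<not> loop_at \<beta> v" for a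
    using quasi_loop_connected_wordI[OF that] assms(1) by blast
  have N2: "\<exists>v. a < v \<and> v + a \<le> length \<beta> \<and> \<not> loop_at \<beta> v"
    if a: "a \<le> length \<beta>" and zeros: "\<And>v. length \<beta> < v + a \<Longrightarrow> \<not> loop_at \<beta> v" for a
  proof -
    \<comment> \<open>A trailing loopless block of \<open>\<beta>\<close> is a leading one of
      \<open>rev \<beta>\<close>.\<close>
    have "\<exists>v. a < v \<and> v + a \<le> length \<beta> \<and> \<not> loop_at (rev \<beta>) v"
    proof (rule ccontr)
      assume "\<not> ?thesis"
      then have "quasi_loop_connected_word (rev \<beta>)"
        using a zeros by (intro quasi_loop_connected_wordI[of a]) (auto simp: loop_at_rev)
      then show False using assms(2) by blast
    qed
    then obtain v where "a < v" "v + a \<le> length \<beta>" "\<not> loop_at (rev \<beta>) v" by blast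
    then show ?thesis by (intro exI[of _ "length \<beta> + 1 - v"]) (auto simp: loop_at_rev)
  qed
  obtain P Q h where g: "gap \<beta> P Q" "P + h < length \<beta>" "h + 1 < Q"
    and cover: "\<And>v. v \<in> {1..length \<beta>} \<Longrightarrow> \<exists>u. loop_at \<beta> u \<and> u \<le> v + h \<and> v \<le> u + h"
    using separating_gap_exists[OF N1 N2] by blast
  have P: "P \<in> {1..length \<beta>}" using g(1) by (simp add: gap_def loop_at_def)
  show ?thesis
  proof (rule EGP_if_separating[where a = 1 and b = "length \<beta>" and B = "{..P}"])
    fix k f assume "f \<in> operations (id_Pol (path_graph \<beta>)) k"
    then interpret path_operation \<beta> k f by unfold_locales
    show "\<exists>i<k. \<forall>xs\<in>nlists k (verts (path_graph \<beta>)).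
        (xs ! i \<in> {..P} \<longrightarrow> f xs \<noteq> length \<beta>) \<and> (xs ! i \<notin> {..P} \<longrightarrow> f xs \<noteq> 1)"
      using gap_separates[OF g cover] by simp
  qed (use P g(2) in auto)
qed

subsection \<open>Ternary polymorphisms and polynomial growth\<close>

text \<open>The largest integer that is at most \<open>v\<close> and has the parity of
  \<open>w\<close>.\<close>

definition parity_floor :: "int \<Rightarrow> int \<Rightarrow> int" where
  "parity_floor v w = v - (v - w) mod 2"

lemma parity_floor_bounds: "v - 1 \<le> parity_floor v w" "parity_floor v w \<le> v"
  by (auto simp: parity_floor_def)

lemma parity_floor_parity: "even (parity_floor v w - w)"
  by (simp add: parity_floor_def) presburger

lemma parity_floor_same: "even (v - w) \<Longrightarrow> parity_floor v w = v"
  by (simp add: parity_floor_def even_iff_mod_2_eq_zero)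

text \<open>The parity of \<open>w\<close> flips, so the difference is odd, and rounding keeps it
  within 2. Here \<open>v\<close> may stand still, as it can at a loop.\<close>

lemma parity_floor_step:
  assumes "\<bar>w - w'\<bar> = 1" "\<bar>v - v'\<bar> \<le> 1"
  shows "\<bar>parity_floor v w - parity_floor v' w'\<bar> = 1"
proof -
  have "odd (parity_floor v w - parity_floor v' w')"
    using parity_floor_parity[of v w] parity_floor_parity[of v' w'] assms(1) by presburger
  moreover have "\<bar>parity_floor v w - parity_floor v' w'\<bar> \<le> 2"
    using parity_floor_bounds[of v w] parity_floor_bounds[of v' w'] assms(2) by linarith
  ultimately show ?thesis by presburger
qed

text \<open>Numbers of equal parity coincide or are at least 2 apart; in the latter case a single
  step cannot reverse their order.\<close>

lemma min_step:
  fixes a b :: int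
  assumes "even (a - b)" "\<bar>a - a'\<bar> = 1" "\<bar>b - b'\<bar> = 1"
  shows "\<bar>min a b - min a' b'\<bar> = 1"
proof -
  have "a = b \<or> 2 \<le> \<bar>a - b\<bar>" using assms(1) by presburger
  then show ?thesis using assms(2,3) by (auto simp: min_def)
qed

lemma max_min_dist_le:
  fixes a b :: int
  assumes "\<bar>a - a'\<bar> \<le> 1" "\<bar>b - b'\<bar> \<le> 1"
  shows "\<bar>max a b - max a' b'\<bar> \<le> 1" "\<bar>min a b - min a' b'\<bar> \<le> 1"
  using assms by (auto simp: max_def min_def)

text \<open>The parity shared by at least two of three numbers. As long as all three move by exactly one,
  the pattern of equal parities stays the same.\<close>

definition majority_parity :: "int \<Rightarrow> int \<Rightarrow> int \<Rightarrow> int" where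
  "majority_parity x y z = (if even (x - y) then x else z)"

text \<open>On loopless vertices all arguments move at once, and a plain minimum of numbers of mixed
  parity could then stand still; hence the rounding to a common parity.\<close>

definition parity_min :: "int \<Rightarrow> int \<Rightarrow> int \<Rightarrow> int" where
  "parity_min x y z = (let w = majority_parity x y z in
     min (parity_floor x w) (min (parity_floor y w) (parity_floor z w)))"

lemma majority_parity_step:
  assumes "\<bar>x - x'\<bar> = 1" "\<bar>y - y'\<bar> = 1" "\<bar>z - z'\<bar> = 1"
  shows "\<bar>majority_parity x y z - majority_parity x' y' z'\<bar> = 1"
proof -
  have "even (x - y) \<longleftrightarrow> even (x' - y')" using assms by presburger
  then show ?thesis using assms by (simp add: majority_parity_def)
qed

lemma parity_min_step:
  assumes "\<bar>x - x'\<bar> = 1" "\<bar>y - y'\<bar> = 1" "\<bar>z - z'\<bar> = 1"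
  shows "\<bar>parity_min x y z - parity_min x' y' z'\<bar> = 1"
proof -
  let ?w = "majority_parity x y z" and ?w' = "majority_parity x' y' z'"
  have st: "\<bar>parity_floor v ?w - parity_floor v' ?w'\<bar> = 1" if "\<bar>v - v'\<bar> = 1" for v v'
    using majority_parity_step[OF assms] that by (intro parity_floor_step) auto
  have ev: "even (parity_floor v ?w - parity_floor v' ?w)" for v v'
    using parity_floor_parity[of v ?w] parity_floor_parity[of v' ?w] by simp
  have "even (parity_floor x ?w - min (parity_floor y ?w) (parity_floor z ?w))"
    using ev by (auto simp: min_def)
  then show ?thesis unfolding parity_min_def Let_def
    using st assms ev by (intro min_step) auto
qed

lemma parity_min_le: "parity_min x y z \<le> x" "parity_min x y z \<le> y" "parity_min x y z \<le> z"
  using parity_floor_bounds(2)[of _ "majority_parity x y z"]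
  unfolding parity_min_def Let_def by (metis min.coboundedI1 min.coboundedI2)+

lemma parity_min_nonneg: "1 \<le> x \<Longrightarrow> 1 \<le> y \<Longrightarrow> 1 \<le> z \<Longrightarrow> 0 \<le> parity_min x y z"
  using parity_floor_bounds(1)[of x "majority_parity x y z"]
    parity_floor_bounds(1)[of y "majority_parity x y z"]
    parity_floor_bounds(1)[of z "majority_parity x y z"]
  unfolding parity_min_def Let_def by simp

lemma parity_floor_ge: "a \<le> v \<Longrightarrow> a \<le> parity_floor v a"
  by (cases "v = a") (use parity_floor_bounds(1)[of v a] in \<open>auto simp: parity_floor_def\<close>)

text \<open>The two equal arguments determine the majority, and \<open>b\<close> rounded to their
  parity does not drop below \<open>a\<close>. After a change of sign this reaches the negative
  coordinates with one argument fixed at the left end.\<close>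

lemma parity_min_two:
  assumes "a \<le> b"
  shows "parity_min b a a = a" "parity_min a b a = a" "parity_min a a b = a"
proof -
  have aa: "parity_floor a a = a" by (simp add: parity_floor_def)
  show "parity_min a b a = a" "parity_min a a b = a"
    using parity_floor_ge[OF assms] aa by (auto simp: parity_min_def majority_parity_def)
  show "parity_min b a a = a"
  proof (cases "even (b - a)")
    case True
    then have "parity_floor a b = a" by (intro parity_floor_same) presburger
    then show ?thesis using True assms parity_floor_same[of b b]
      by (simp add: parity_min_def majority_parity_def)
  next
    case False
    then show ?thesis using parity_floor_ge[OF assms] aa
      by (simp add: parity_min_def majority_parity_def)
  qed
qed

text \<open>Adjacency on a two-way infinite path, loopless beyond the ends of the word; the range of
  vertices is checked separately.\<close>

definition path_adj :: "bool list \<Rightarrow> int \<Rightarrow> int \<Rightarrow> int \<Rightarrow> bool" where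
  "path_adj \<beta> c x y \<longleftrightarrow> \<bar>x - y\<bar> = 1 \<or> x = y \<and> loop_at \<beta> (nat (x + c))"

lemma path_adj_sym: "path_adj \<beta> c x y \<longleftrightarrow> path_adj \<beta> c y x"
  by (auto simp: path_adj_def)

lemma path_adj_dist: "path_adj \<beta> c x y \<Longrightarrow> \<bar>x - y\<bar> \<le> 1"
  by (auto simp: path_adj_def)

text \<open>Vertex \<open>v\<close> gets the coordinate \<open>v - c\<close>.\<close>

lemma PGP_path_graphI:
  fixes \<beta> :: "bool list" and F :: "int \<Rightarrow> int \<Rightarrow> int \<Rightarrow> int" and c s :: int
  defines "I \<equiv> {1 - c..int (length \<beta>) - c}"
  assumes closed: "\<And>x y z. x \<in> I \<Longrightarrow> y \<in> I \<Longrightarrow> z \<in> I \<Longrightarrow> F x y z \<in> I"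
    and adj: "\<And>x y z x' y' z'. path_adj \<beta> c x x' \<Longrightarrow> path_adj \<beta> c y y' \<Longrightarrow> path_adj \<beta> c z z' \<Longrightarrow>
      {x, y, z, x', y', z'} \<subseteq> I \<Longrightarrow> path_adj \<beta> c (F x y z) (F x' y' z')"
    and idem: "\<And>x. x \<in> I \<Longrightarrow> F x x x = x"
    and s: "s \<in> I"
    and surj: "\<And>a. a \<in> I \<Longrightarrow> \<exists>y\<in>I. \<exists>z\<in>I. F s y z = a" "\<And>a. a \<in> I \<Longrightarrow> \<exists>x\<in>I. \<exists>z\<in>I. F x s z = a"
      "\<And>a. a \<in> I \<Longrightarrow> \<exists>x\<in>I. \<exists>y\<in>I. F x y s = a"
  shows "PGP (id_Pol (path_graph \<beta>))"
proof -
  let ?V = "{1..length \<beta>}"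
  let ?u = "\<lambda>v. int v - c" and ?v = "\<lambda>x. nat (x + c)"
  let ?f = "\<lambda>xs. ?v (F (?u (xs ! 0)) (?u (xs ! 1)) (?u (xs ! 2)))"
  have uI: "?u v \<in> I" if "v \<in> ?V" for v using that by (auto simp: I_def)
  have vV: "?v x \<in> ?V" "?u (?v x) = x" if "x \<in> I" for x using that by (auto simp: I_def)
  have edge: "(v, w) \<in> edges (path_graph \<beta>) \<longleftrightarrow> path_adj \<beta> c (?u v) (?u w)"
    if "v \<in> ?V" "w \<in> ?V" for v w
    using that by (auto simp: edges_path_graph path_adj_def)
  have FI: "F (?u (xs ! 0)) (?u (xs ! 1)) (?u (xs ! 2)) \<in> I" if "xs \<in> nlists 3 ?V" for xs
    using that by (intro closed uI) (auto simp: nlists_iff_nth)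
  have "polymorphism (path_graph \<beta>) 3 ?f"
    unfolding polymorphism_def verts_path_graph
  proof (intro conjI ballI impI)
    show "?f xs \<in> ?V" if "xs \<in> nlists 3 ?V" for xs using vV(1)[OF FI[OF that]] .
  next
    fix xs ys assume xs: "xs \<in> nlists 3 ?V" and ys: "ys \<in> nlists 3 ?V"
      and e: "\<forall>i<3. (xs ! i, ys ! i) \<in> edges (path_graph \<beta>)"
    have V: "xs ! i \<in> ?V" "ys ! i \<in> ?V" if "i < 3" for i
      using xs ys that by (auto simp: nlists_iff_nth)
    have "path_adj \<beta> c (?u (xs ! i)) (?u (ys ! i))" if "i < 3" for i
      using e that edge[OF V[OF that]] by blast
    then have "path_adj \<beta> c (F (?u (xs ! 0)) (?u (xs ! 1)) (?u (xs ! 2)))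
        (F (?u (ys ! 0)) (?u (ys ! 1)) (?u (ys ! 2)))"
      using uI[OF V(1)] uI[OF V(2)] by (intro adj) auto
    then show "(?f xs, ?f ys) \<in> edges (path_graph \<beta>)"
      using edge[OF vV(1)[OF FI[OF xs]] vV(1)[OF FI[OF ys]]] vV(2)[OF FI[OF xs]] vV(2)[OF FI[OF ys]]
      by simp
  qed
  moreover have "idempotent ?V 3 ?f"
    unfolding idempotent_def
  proof
    fix a assume "a \<in> ?V"
    then show "?f (replicate 3 a) = a" using idem[OF uI[of a]] by simp
  qed
  ultimately have op: "?f \<in> operations (id_Pol (path_graph \<beta>)) 3"
    by (simp add: operations_id_Pol)
  show ?thesis
  proof (rule PGP_if_surjective_with_fixed_entry[OF _ _ op, where x = "?v s"])
    fix i a assume i: "i < (3::nat)" and "a \<in> verts (path_graph \<beta>)"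
    then have a: "?u a \<in> I" using uI by simp
    have *: "\<exists>xs\<in>nlists 3 ?V. xs ! i = ?v s \<and> ?f xs = a"
      if "x \<in> I" "y \<in> I" "z \<in> I" "F x y z = ?u a" "[x, y, z] ! i = s" for x y z
    proof (intro bexI[of _ "[?v x, ?v y, ?v z]"] conjI)
      have "[?v x, ?v y, ?v z] ! i = map ?v [x, y, z] ! i" by simp
      also have "\<dots> = ?v s" using that(5) i by (subst nth_map) auto
      finally show "[?v x, ?v y, ?v z] ! i = ?v s" .
      show "?f [?v x, ?v y, ?v z] = a" using vV(2)[OF that(1)] vV(2)[OF that(2)] vV(2)[OF that(3)] that(4)
        by (simp add: numeral_2_eq_2)
      show "[?v x, ?v y, ?v z] \<in> nlists 3 ?V"
        using vV(1)[OF that(1)] vV(1)[OF that(2)] vV(1)[OF that(3)] by (simp add: nlists_def)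
    qed
    consider "i = 0" | "i = 1" | "i = 2" using i by linarith
    then have "\<exists>x\<in>I. \<exists>y\<in>I. \<exists>z\<in>I. F x y z = ?u a \<and> [x, y, z] ! i = s"
    proof cases
      case 1 then show ?thesis using surj(1)[OF a] s by auto
    next
      case 2 then show ?thesis using surj(2)[OF a] s by auto
    next
      case 3 then show ?thesis using surj(3)[OF a] s by (auto simp: numeral_2_eq_2)
    qed
    then show "\<exists>xs\<in>nlists 3 (verts (path_graph \<beta>)). xs ! i = ?v s \<and> ?f xs = a"
      using * by auto
  qed (use vV(1)[OF s] in auto)
qed

text \<open>Without loops all arguments move by exactly one, so their pattern of parities is
  invariant and \<open>F\<close> can be chosen for each pattern separately: the minimum if all
  parities agree, otherwise an argument of the majority parity. With the right end once and
  \<open>a\<close> twice, either rule yields \<open>a\<close>.\<close>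

lemma PGP_loopless_path:
  assumes noloop: "\<And>v. \<not> loop_at \<beta> v"
  shows "PGP (id_Pol (path_graph \<beta>))"
proof (cases "\<beta> = []")
  case True
  then show ?thesis by (intro PGP_empty) simp
next
  case False
  let ?n = "int (length \<beta>)"
  define F :: "int \<Rightarrow> int \<Rightarrow> int \<Rightarrow> int" where
    "F x y z = (if even (x - y) \<and> even (x - z) then min x (min y z) else majority_parity x y z)"
    for x y z
  have idem: "F a a a = a" for a by (simp add: F_def)
  have two: "F ?n a a = a" "F a ?n a = a" "F a a ?n = a" if "a \<le> ?n" for a
    using that by (auto simp: F_def majority_parity_def)
  show ?thesis
  proof (rule PGP_path_graphI[where F = F and c = 0 and s = ?n])
    show "F x y z \<in> {1 - 0..?n - 0}"
      if "x \<in> {1 - 0..?n - 0}" "y \<in> {1 - 0..?n - 0}" "z \<in> {1 - 0..?n - 0}" for x y z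
      using that by (auto simp: F_def majority_parity_def)
  next
    fix x y z x' y' z'
    assume "path_adj \<beta> 0 x x'" "path_adj \<beta> 0 y y'" "path_adj \<beta> 0 z z'"
    then have st: "\<bar>x - x'\<bar> = 1" "\<bar>y - y'\<bar> = 1" "\<bar>z - z'\<bar> = 1"
      using noloop by (auto simp: path_adj_def)
    have same: "even (x - y) \<longleftrightarrow> even (x' - y')" "even (x - z) \<longleftrightarrow> even (x' - z')"
      using st by presburger+
    have "\<bar>F x y z - F x' y' z'\<bar> = 1"
    proof (cases "even (x - y) \<and> even (x - z)")
      case True
      then have "even (y - z)" "even (x - min y z)" by (auto simp: min_def)
      then have "\<bar>min x (min y z) - min x' (min y' z')\<bar> = 1"
        using st by (intro min_step) auto
      moreover have "even (x' - y') \<and> even (x' - z')" using True same by blast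
      ultimately show ?thesis unfolding F_def using True by (simp only: if_True simp_thms)
    next
      case False
      then show ?thesis using majority_parity_step[OF st] same by (auto simp: F_def)
    qed
    then show "path_adj \<beta> 0 (F x y z) (F x' y' z')" by (simp add: path_adj_def)
  qed (use False idem two in \<open>auto simp: Suc_le_eq intro!: bexI\<close>)
qed

text \<open>The interval \<open>{0..e}\<close> of loops is flanked by \<open>L\<close> loopless vertices on the left, at the
  negative coordinates, and by at most \<open>L\<close> arbitrary vertices on the right. Next to the triples of
  negative numbers and to those of the second case the last case yields \<open>0\<close> and \<open>e\<close>, respectively.\<close>

definition loop_interval_op :: "int \<Rightarrow> int \<Rightarrow> int \<Rightarrow> int \<Rightarrow> int" where
  "loop_interval_op e x y z =
    (if x < 0 \<and> y < 0 \<and> z < 0 then - parity_min (- x) (- y) (- z)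
     else if x < 0 \<and> z < 0 \<and> e \<le> y then
       e + max 0 (min (min (parity_floor (- x) z) (- z)) (parity_floor (y - e) z))
     else max x (min e (max 0 (max y z))))"

lemma loop_interval_op_adj:
  assumes e: "0 \<le> e"
    and neg: "\<And>u. u < 0 \<Longrightarrow> \<not> loop_at \<beta> (nat (u + c))"
    and loops: "\<And>u. 0 \<le> u \<Longrightarrow> u \<le> e \<Longrightarrow> loop_at \<beta> (nat (u + c))"
    and x: "path_adj \<beta> c x x'" and y: "path_adj \<beta> c y y'" and z: "path_adj \<beta> c z z'"
  shows "path_adj \<beta> c (loop_interval_op e x y z) (loop_interval_op e x' y' z')"
proof -
  let ?F = "loop_interval_op e"
  \<comment> \<open>The regions of the first two cases of the operation, disjoint as
    \<open>0 \<le> e\<close>. Steps within each region and across each boundary are treated in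
    turn.\<close>
  let ?R1 = "\<lambda>x y z::int. x < 0 \<and> y < 0 \<and> z < 0"
  let ?R2 = "\<lambda>x y z. x < 0 \<and> z < 0 \<and> e \<le> y"
  have step: "\<bar>u - u'\<bar> = 1" if "path_adj \<beta> c u u'" "u < 0" for u u'
    using that neg by (auto simp: path_adj_def)
  have near: "path_adj \<beta> c u u'" if "0 \<le> u" "u \<le> e" "0 \<le> u'" "u' \<le> e" "\<bar>u - u'\<bar> \<le> 1" for u u'
    using that loops[of u] by (cases "u = u'") (auto simp: path_adj_def)
  have R1: "\<bar>?F x y z - 0\<bar> \<le> 1 \<and> ?F x y z \<le> 0" if "?R1 x y z" "x = -1 \<or> y = -1 \<or> z = -1" for x y z
    using that parity_min_le[of "-x" "-y" "-z"] parity_min_nonneg[of "-x" "-y" "-z"]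
    by (auto simp: loop_interval_op_def)
  have to0: "path_adj \<beta> c u 0" if "\<bar>u - 0\<bar> \<le> 1 \<and> u \<le> 0" for u
    using that loops[of 0] e by (cases "u = 0") (auto simp: path_adj_def)
  have from_R1: "path_adj \<beta> c (?F x y z) (?F x' y' z')"
    if r: "?R1 x y z" "\<not> ?R1 x' y' z'" and a: "path_adj \<beta> c x x'" "path_adj \<beta> c y y'" "path_adj \<beta> c z z'"
    for x y z x' y' z'
  proof -
    have st: "\<bar>x - x'\<bar> = 1" "\<bar>y - y'\<bar> = 1" "\<bar>z - z'\<bar> = 1" using r a step by auto
    \<comment> \<open>An entry leaving the negative numbers goes from -1 to 0. The value before the
      step is then -1 or 0, and after it 0, which has a loop.\<close>
    then have one: "x = -1 \<or> y = -1 \<or> z = -1" using r by linarith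
    have "?F x' y' z' = 0"
      using st r e parity_floor_bounds(2)[of "y' - e" z'] by (auto simp: loop_interval_op_def)
    then show ?thesis using to0[OF R1[OF r(1) one]] by simp
  qed
  have from_R2: "path_adj \<beta> c (?F x y z) (?F x' y' z')"
    if r: "?R2 x y z" "\<not> ?R1 x' y' z'" "\<not> ?R2 x' y' z'"
      and a: "path_adj \<beta> c x x'" "path_adj \<beta> c y y'" "path_adj \<beta> c z z'"
    for x y z x' y' z'
  proof -
    have st: "\<bar>x - x'\<bar> = 1" "\<bar>y - y'\<bar> \<le> 1" "\<bar>z - z'\<bar> = 1" using r a step path_adj_dist by auto
    have F: "?F x y z = e + max 0 (min (min (parity_floor (- x) z) (- z)) (parity_floor (y - e) z))"
      using r e by (auto simp: loop_interval_op_def)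
    have F': "?F x' y' z' = max x' (min e (max 0 (max y' z')))"
      using r unfolding loop_interval_op_def by auto
    show ?thesis
    proof (cases "x' < 0 \<and> z' < 0")
      case True
      \<comment> \<open>Here only \<open>y\<close> leaves its range, from \<open>e\<close> to
        \<open>e - 1\<close>, and the value does the same.\<close>
      then have "y = e" "y' = e - 1" "0 \<le> e - 1" using r st by auto
      then have "?F x y z = e" "?F x' y' z' = e - 1"
        using F F' True parity_floor_bounds(2)[of "y - e" z] by auto
      then show ?thesis by (simp add: path_adj_def)
    next
      case False
      \<comment> \<open>Here \<open>x\<close> or \<open>z\<close> reaches 0; the term built from it
        is at most 1, so the value is at most \<open>e + 1\<close>.\<close>
      then have one: "x = -1 \<or> z = -1" using r st by linarith
      have x'z': "x' \<le> 0" "z' \<le> 0" using r st by auto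
      have "min (min (parity_floor (- x) z) (- z)) (parity_floor (y - e) z) \<le> 1"
        using one parity_floor_bounds(2)[of "-x" z] by auto
      then have Fe: "?F x y z = e \<or> ?F x y z = e + 1" using F by auto
      show ?thesis
      proof (cases "e \<le> y'")
        case True
        then have "?F x' y' z' = e" using F' x'z' e by auto
        then show ?thesis using Fe loops[of e] e by (auto simp: path_adj_def)
      next
        case False
        then have y: "y = e" "y' = e - 1" using r st by auto
        then have "?F x y z = e" using F parity_floor_bounds(2)[of "y - e" z] by auto
        moreover have "?F x' y' z' = max 0 (e - 1)" using F' y x'z' e by auto
        ultimately show ?thesis using e by (intro near) auto
      qed
    qed
  qed
  consider (R11) "?R1 x y z" "?R1 x' y' z'" | (R1) "?R1 x y z" "\<not> ?R1 x' y' z'"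
    | (R1') "\<not> ?R1 x y z" "?R1 x' y' z'"
    | (R22) "?R2 x y z" "?R2 x' y' z'"
    | (R2) "?R2 x y z" "\<not> ?R1 x' y' z'" "\<not> ?R2 x' y' z'"
    | (R2') "?R2 x' y' z'" "\<not> ?R1 x y z" "\<not> ?R2 x y z"
    | (R33) "\<not> ?R1 x y z" "\<not> ?R2 x y z" "\<not> ?R1 x' y' z'" "\<not> ?R2 x' y' z'" by blast
  then show ?thesis
  proof cases
    case R11
    then have "\<bar>x - x'\<bar> = 1" "\<bar>y - y'\<bar> = 1" "\<bar>z - z'\<bar> = 1" using x y z step by auto
    then have "\<bar>parity_min (-x) (-y) (-z) - parity_min (-x') (-y') (-z')\<bar> = 1"
      by (intro parity_min_step) auto
    then show ?thesis using R11 by (simp add: loop_interval_op_def path_adj_def abs_minus_commute)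
  next
    case R1
    then show ?thesis using from_R1 x y z by blast
  next
    case R1'
    then show ?thesis using from_R1 x y z path_adj_sym by blast
  next
    case R22
    have st: "\<bar>x - x'\<bar> = 1" "\<bar>y - y'\<bar> \<le> 1" "\<bar>z - z'\<bar> = 1"
      using R22 x y z step path_adj_dist by auto
    \<comment> \<open>As \<open>z\<close> is negative it moves by exactly one and can set the parity
      for all three terms, although \<open>y\<close> may stand still at a loop.\<close>
    let ?m = "\<lambda>x y z. min (min (parity_floor (- x) z) (- z)) (parity_floor (y - e) z)"
    have ev: "even (parity_floor (- x) z - (- z))" "even (- z - parity_floor (y - e) z)"
      "even (parity_floor (- x) z - parity_floor (y - e) z)"
      using parity_floor_parity[of "-x" z] parity_floor_parity[of "y - e" z] by presburger+
    have "\<bar>?m x y z - ?m x' y' z'\<bar> = 1"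
      using st ev by (intro min_step parity_floor_step) (auto simp: min_def)
    moreover have "?F x y z = e + max 0 (?m x y z)" "?F x' y' z' = e + max 0 (?m x' y' z')"
      using R22 e by (auto simp: loop_interval_op_def)
    moreover have "path_adj \<beta> c (e + max 0 m) (e + max 0 m')" if "\<bar>m - m'\<bar> = 1" for m m'
    proof (cases "m \<le> 0 \<and> m' \<le> 0")
      case True
      then show ?thesis using loops[of e] e by (simp add: path_adj_def max_absorb1)
    next
      case False
      then have "\<bar>(e + max 0 m) - (e + max 0 m')\<bar> = 1" using that by linarith
      then show ?thesis by (simp add: path_adj_def)
    qed
    ultimately show ?thesis by simp
  next
    case R2
    then show ?thesis using from_R2 x y z by blast
  next
    case R2'
    then show ?thesis using from_R2 x y z path_adj_sym by blast
  next
    case R33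
    define m m' where "m = min e (max 0 (max y z))" and "m' = min e (max 0 (max y' z'))"
    have F: "?F x y z = max x m" "?F x' y' z' = max x' m'"
      using R33 unfolding loop_interval_op_def m_def m'_def by auto
    have st: "\<bar>x - x'\<bar> \<le> 1" "\<bar>y - y'\<bar> \<le> 1" "\<bar>z - z'\<bar> \<le> 1" using x y z path_adj_dist by auto
    have m: "0 \<le> m" "m \<le> e" "0 \<le> m'" "m' \<le> e" using e by (simp_all add: m_def m'_def)
    have "\<bar>m - m'\<bar> \<le> 1"
      unfolding m_def m'_def using st by (intro max_min_dist_le) auto
    then have dist: "\<bar>max x m - max x' m'\<bar> \<le> 1"
      using st by (intro max_min_dist_le) auto
    \<comment> \<open>Up to \<open>e\<close> both values lie among the loops, where distance at most
      one suffices. Beyond \<open>e\<close> the value is \<open>x\<close> itself and inherits its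
      adjacency, so the loops there may be arbitrary.\<close>
    show ?thesis
    proof (cases "x \<le> e \<and> x' \<le> e")
      case True
      then show ?thesis unfolding F using dist m by (intro near) auto
    next
      case False
      then have "max x m = x" "max x' m' = x'" using st m by auto
      then show ?thesis using F x by simp
    qed
  qed
qed

lemma PGP_loop_interval_path:
  assumes "\<beta> = replicate L False @ replicate b True @ \<alpha>" "b > 0" "length \<alpha> \<le> L"
  shows "PGP (id_Pol (path_graph \<beta>))"
proof -
  define e where "e = int b - 1"
  \<comment> \<open>These coordinates place the block of loops at \<open>{0..e}\<close> and the left
    end at \<open>- int L\<close>.\<close>
  define c where "c = int L + 1"
  have e: "0 \<le> e" using assms(2) by (simp add: e_def)
  have n: "int (length \<beta>) - c = e + int (length \<alpha>)" using assms(1) by (simp add: e_def c_def)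
  have r: "int (length \<alpha>) \<le> int L" using assms(3) by simp
  have lo: "1 - c = - int L" by (simp add: c_def)
  have neg: "\<not> loop_at \<beta> (nat (u + c))" if "u < 0" for u
    using that assms(1) by (auto simp: loop_at_def c_def nth_append)
  have loops: "loop_at \<beta> (nat (u + c))" if "0 \<le> u" "u \<le> e" for u
    using that assms(1) by (auto simp: loop_at_def c_def e_def nth_append nat_diff_distrib)
  let ?F = "loop_interval_op e"
  let ?I = "{- int L..e + int (length \<alpha>)}"
  have mid: "?F a (- int L) a = a" "?F a a (- int L) = a" if "a \<in> ?I" for a
    using that e parity_min_two(2,3)[of "- a" "int L"] by (auto simp: loop_interval_op_def)
  show ?thesis
  proof (rule PGP_path_graphI[where F = ?F and c = c and s = "- int L"], unfold n lo)
    fix x y z assume "x \<in> ?I" "y \<in> ?I" "z \<in> ?I"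
    then show "?F x y z \<in> ?I"
      using e r parity_min_le(1)[of "-x" "-y" "-z"] parity_min_nonneg[of "-x" "-y" "-z"]
        parity_floor_bounds(2)[of "y - e" z]
      by (auto simp: loop_interval_op_def)
  next
    fix x y z x' y' z'
    assume "path_adj \<beta> c x x'" "path_adj \<beta> c y y'" "path_adj \<beta> c z z'"
    then show "path_adj \<beta> c (?F x y z) (?F x' y' z')"
      by (intro loop_interval_op_adj e neg loops)
  next
    fix x assume "x \<in> ?I"
    show "?F x x x = x"
      using parity_min_two(1)[of "-x" "-x"] e by (auto simp: loop_interval_op_def)
  next
    show "- int L \<in> ?I" using e by auto
  next
    fix a assume a: "a \<in> ?I"
    consider "a < 0" | "0 \<le> a" "a \<le> e" | "e < a" by linarith
    then show "\<exists>y\<in>?I. \<exists>z\<in>?I. ?F (- int L) y z = a"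
    proof cases
      case 1
      then have "?F (- int L) a a = a"
        using a parity_min_two(1)[of "- a" "int L"] by (auto simp: loop_interval_op_def)
      then show ?thesis using a by blast
    next
      case 2
      then have "?F (- int L) a 0 = a" by (auto simp: loop_interval_op_def)
      then show ?thesis using a e by (intro bexI[of _ a] bexI[of _ 0]) auto
    next
      case 3
      \<comment> \<open>The value comes from the second case of the operation: \<open>- z\<close> is
        the largest number up to \<open>L\<close> with the parity of \<open>a - e\<close>, and
        \<open>length \<alpha> \<le> L\<close> gives \<open>a - e \<le> L\<close>. So all three
        terms are at least \<open>a - e\<close> and the last one equals it.\<close>
      define z where "z = - parity_floor (int L) (a - e)"
      have aL: "a - e \<le> int L" using a r by auto
      then have z: "z < 0" "- int L \<le> z" "a - e \<le> - z"
        using 3 parity_floor_ge[OF aL] parity_floor_bounds(2)[of "int L" "a - e"] by (auto simp: z_def)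
      have "even (a - e - z)" using parity_floor_parity[of "int L" "a - e"] unfolding z_def by presburger
      then have "parity_floor (a - e) z = a - e" by (rule parity_floor_same)
      moreover have "a - e \<le> parity_floor (int L) z"
      proof -
        have "parity_floor (int L) z = parity_floor (int L) (a - e)"
          using \<open>even (a - e - z)\<close> unfolding parity_floor_def by presburger
        then show ?thesis using parity_floor_ge[OF aL] by simp
      qed
      ultimately have "?F (- int L) a z = a"
        using z 3 e by (auto simp: loop_interval_op_def)
      then show ?thesis using a z e by (intro bexI[of _ a] bexI[of _ z]) auto
    qed
  next
    fix a assume a: "a \<in> ?I"
    show "\<exists>x\<in>?I. \<exists>z\<in>?I. ?F x (- int L) z = a" using mid(1)[OF a] a by blast
    show "\<exists>x\<in>?I. \<exists>y\<in>?I. ?F x y (- int L) = a" using mid(2)[OF a] a by blast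
  qed
qed

lemma PGP_path_graph:
  assumes "quasi_loop_connected_word \<beta>"
  shows "PGP (id_Pol (path_graph \<beta>))"
proof -
  consider (loops) a b \<alpha> where "\<beta> = replicate a False @ replicate b True @ \<alpha>" "b > 0" "length \<alpha> = a"
    | (half) a \<alpha> where "\<beta> = replicate a False @ \<alpha>" "length \<alpha> = a \<or> length \<alpha> + 1 = a"
    using assms unfolding quasi_loop_connected_word_def by blast
  then show ?thesis
  proof cases
    case loops
    then show ?thesis by (intro PGP_loop_interval_path) auto
  next
    case half
    show ?thesis
    proof (cases "True \<in> set \<alpha>")
      case True
      \<comment> \<open>Splitting at the first 1 leaves at least as many zeros before it as letters
        after it, so this single loop serves as the block.\<close>
      then obtain \<gamma> \<delta> where \<alpha>: "\<alpha> = \<gamma> @ True # \<delta>" "True \<notin> set \<gamma>" by (metis split_list_first)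
      then have "\<gamma> = replicate (length \<gamma>) False" by (metis (full_types) replicate_eqI)
      then have "\<beta> = replicate (a + length \<gamma>) False @ replicate 1 True @ \<delta>"
        using half(1) \<alpha>(1) by (simp add: replicate_add)
      then show ?thesis by (rule PGP_loop_interval_path) (use half(2) \<alpha>(1) in auto)
    next
      case False
      then have "True \<notin> set \<beta>" using half(1) by auto
      then have "\<not> loop_at \<beta> v" for v by (auto simp: loop_at_def in_set_conv_nth)
      then show ?thesis by (rule PGP_loopless_path)
    qed
  qed
qed

subsection \<open>The dichotomy\<close>

theorem theorem1:
  fixes H :: "'a graph"
  assumes "partially_reflexive_path H"
  shows "(quasi_loop_connected H \<longrightarrow> PGP (id_Pol H)) \<and>
         (\<not> quasi_loop_connected H \<longrightarrow> EGP (id_Pol H))"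
proof (intro conjI impI)
  \<comment> \<open>Both growth properties depend only on \<open>min_generators\<close>, which
    isomorphisms preserve.\<close>
  have iso: "min_generators (id_Pol H) = min_generators (id_Pol (path_graph \<beta>))"
    if "graph_iso H (path_graph \<beta>)" for \<beta>
    using that by (rule min_generators_graph_iso) simp
  show "PGP (id_Pol H)" if "quasi_loop_connected H"
  proof -
    from that obtain \<beta> where "quasi_loop_connected_word \<beta>" "graph_iso H (path_graph \<beta>)"
      by (auto simp: quasi_loop_connected_def)
    then show ?thesis using PGP_path_graph[of \<beta>] iso[of \<beta>] by (simp add: PGP_def)
  qed
  show "EGP (id_Pol H)" if not: "\<not> quasi_loop_connected H"
  proof -
    from assms obtain \<beta> where H: "undirected_graph H" "graph_iso H (path_graph \<beta>)"
      by (auto simp: partially_reflexive_path_def)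
    \<comment> \<open>Both words describe \<open>H\<close>, so neither is
      quasi-loop-connected.\<close>
    then have "graph_iso H (path_graph (rev \<beta>))"
      using graph_iso_trans graph_iso_path_graph_rev by blast
    then have "EGP (id_Pol (path_graph \<beta>))"
      using H not by (intro EGP_path_graph) (auto simp: quasi_loop_connected_def)
    then show ?thesis using iso[OF H(2)] by (simp add: EGP_def)
  qed
qed

end
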